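(* Let $\gamma:\mathbb{R}\times\mathbb{R}\to\mathbb{R}$ be a measurable function, let $M_\gamma$ be the associated oscillatory maximal function, and suppose that one of the following conditions on $(\gamma,p,l)$ holds: (1) $\gamma(x,t)=\sum_{j=1}^m c_j(x)|t|^{d_j}$, where $c_j\in L^\infty(\mathbb{R})$ for $j=1,\dots,m-1$, $c_m,1/c_m\in L^\infty(\mathbb{R})$, the exponents are real numbers with $2\le d_1<d_2<\cdots<d_m$ and $d_m>2$, and $1<l<2$, $1\le p\le+\infty$; or (2) $\gamma(x,t)=a(x)t^2$ for some measurable function $a$ with $a,1/a\in L^\infty(\mathbb{R})$, and $1<l<2$, $1\le p<+\infty$. Then $M_\gamma:C_{p,l}\to L^1(\mathbb{R})$ is bounded, that is, there is a constant $K$ depending only on $p,l,\gamma$ such that $$\|M_\gamma f\|_1\le K\left(\|(1+|x|^l)f\|_1+\|f'\|_p\right)\quad\text{for all } f\in C_{p,l}.$$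
   Context: For a measurable $\gamma:\mathbb{R}\times\mathbb{R}\to\mathbb{R}$, the oscillatory maximal function is $$M_\gamma f(x)=\sup_{r>0}\frac{1}{2r}\left|\int_{-r}^{r}f(x-t)e^{i\gamma(x,t)}\,dt\right|.$$ For $1\le p\le\infty$ and $l\ge0$, $C_{p,l}=\{f\in\mathcal{S}'(\mathbb{R}):\|(1+|x|^l)f\|_1+\|f'\|_p<+\infty\}$, i.e. the space of functions $f$ on $\mathbb{R}$ with $(1+|x|^l)f\in L^1(\mathbb{R})$ whose weak (distributional) derivative $f'$ belongs to $L^p(\mathbb{R})$. The functions $c_j$ and $a$ are real-valued. *)

theory Defs
  imports "HOL-Probability.Essential_Supremum"
begin

text \<open>The exponent ranges over the extended half-line, with \<open>p = \<infinity>\<close> giving the essential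
  supremum. The case split on an infinite integral is needed because there is no real power
  on \<^typ>\<open>ennreal\<close>.\<close>

definition Lp_norm :: "ennreal \<Rightarrow> 'a measure \<Rightarrow> ('a \<Rightarrow> 'b::real_normed_vector) \<Rightarrow> ennreal" where
  "Lp_norm p M f =
    (if p = \<infinity> then esssup M (\<lambda>x. ennreal (norm (f x)))
     else let I = (\<integral>\<^sup>+ x. ennreal (norm (f x) powr enn2real p) \<partial>M)
          in if I = \<infinity> then \<infinity> else ennreal (enn2real I powr (1 / enn2real p)))"

definition Lp_space :: "ennreal \<Rightarrow> 'a measure \<Rightarrow> ('a \<Rightarrow> 'b::real_normed_vector) set" where
  "Lp_space p M = {f \<in> borel_measurable M. Lp_norm p M f < \<infinity>}"

definition test_function :: "(real \<Rightarrow> real) \<Rightarrow> bool" where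
  "test_function \<phi> \<longleftrightarrow>
    (\<forall>n. (deriv ^^ n) \<phi> differentiable_on UNIV) \<and> compact (closure {x. \<phi> x \<noteq> 0})"

definition locally_integrable :: "(real \<Rightarrow> complex) \<Rightarrow> bool" where
  "locally_integrable f \<longleftrightarrow> (\<forall>C. compact C \<longrightarrow> set_integrable lebesgue C f)"

text \<open>Real-valued test functions suffice for complex-valued \<open>f\<close>, by linearity.\<close>

definition has_weak_derivative :: "(real \<Rightarrow> complex) \<Rightarrow> (real \<Rightarrow> complex) \<Rightarrow> bool" where
  "has_weak_derivative f g \<longleftrightarrow> locally_integrable f \<and> locally_integrable g \<and>
    (\<forall>\<phi>. test_function \<phi> \<longrightarrow>
      (LINT x|lebesgue. deriv \<phi> x *\<^sub>R f x) = - (LINT x|lebesgue. \<phi> x *\<^sub>R g x))"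

text \<open>Elements are representatives of the almost-everywhere classes.\<close>

definition C_space :: "ennreal \<Rightarrow> real \<Rightarrow> (real \<Rightarrow> complex) set" where
  "C_space p l = {f. (\<lambda>x. (1 + \<bar>x\<bar> powr l) *\<^sub>R f x) \<in> Lp_space 1 lebesgue \<and>
    (\<exists>g. has_weak_derivative f g \<and> g \<in> Lp_space p lebesgue)}"

definition osc_maximal :: "(real \<times> real \<Rightarrow> real) \<Rightarrow> (real \<Rightarrow> complex) \<Rightarrow> real \<Rightarrow> ennreal" where
  "osc_maximal \<gamma> f x = (SUP r\<in>{0<..}.
    ennreal (1 / (2 * r) *
      cmod (LINT t:{-r..r}|lebesgue. f (x - t) * exp (\<i> * complex_of_real (\<gamma> (x, t))))))"

text \<open>In \<open>power_phase\<close>, the condition that \<open>c m\<close> is nonzero almost everywhere is part of the meaning of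
  \<open>1 / c m \<in> L\<^sup>\<infinity>\<close>; it has to be explicit since \<open>1 / 0 = 0\<close> here. The same applies to \<open>a\<close> in
  \<open>quadratic_phase\<close>.\<close>

definition power_phase :: "(real \<times> real \<Rightarrow> real) \<Rightarrow> bool" where
  "power_phase \<gamma> \<longleftrightarrow> (\<exists>(m::nat) (c :: nat \<Rightarrow> real \<Rightarrow> real) (d :: nat \<Rightarrow> real).
    1 \<le> m \<and> (\<forall>j\<in>{1..m}. c j \<in> Lp_space \<infinity> lebesgue) \<and>
    (AE x in lebesgue. c m x \<noteq> 0) \<and> (\<lambda>x. 1 / c m x) \<in> Lp_space \<infinity> lebesgue \<and>
    2 \<le> d 1 \<and> strict_mono_on {1..m} d \<and> 2 < d m \<and>
    (\<forall>x t. \<gamma> (x, t) = (\<Sum>j=1..m. c j x * \<bar>t\<bar> powr d j)))"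

definition quadratic_phase :: "(real \<times> real \<Rightarrow> real) \<Rightarrow> bool" where
  "quadratic_phase \<gamma> \<longleftrightarrow> (\<exists>a :: real \<Rightarrow> real.
    a \<in> Lp_space \<infinity> lebesgue \<and>
    (AE x in lebesgue. a x \<noteq> 0) \<and> (\<lambda>x. 1 / a x) \<in> Lp_space \<infinity> lebesgue \<and>
    (\<forall>x t. \<gamma> (x, t) = a x * t\<^sup>2))"

end

theory Submission
  imports Defs
begin

text \<open>
  An element \<open>f\<close> of the space is almost everywhere an indefinite integral \<open>F\<close> of its weak derivative
  \<open>G\<close>. Put \<open>w(x) = 1 + \<bar>x\<bar>\<^sup>l\<close> and let \<open>N\<close> be the Lebesgue norm of \<open>G\<close> with exponent \<open>p\<close>. The maximal
  function at \<open>x\<close> is dominated by four explicit functions of \<open>x\<close>, each with an integral bounded by a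
  multiple of the integral of \<open>w |F|\<close> plus \<open>N\<close>.

  \<^item> For radii \<open>r \<le> 1 / w(x)\<close> the average is at most \<open>|F(x)|\<close> plus the integral of \<open>|G|\<close> over
    \<open>|y - x| \<le> 1 / w(x)\<close>. Since \<open>|G| \<le> N (1 + h)\<close> with an integrable \<open>h\<close>, and \<open>1 / w\<close> is integrable
    because \<open>l > 1\<close>, both are integrable in \<open>x\<close>.

  \<^item> For larger radii \<open>1 / (2 r)\<close> is at most \<open>w(x)\<close>, which suffices for \<open>|t| \<le> 1\<close>. For \<open>|t| > 1\<close> it is
    at most \<open>1\<close>, which suffices on the set \<open>|t| \<le> 3 |x - t|\<close>: there the integral over \<open>x\<close> for fixed
    \<open>y = x - t\<close> has size \<open>|y| \<le> w(y)\<close>. Tonelli's theorem turns both into the integral of \<open>w |F|\<close>.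

  \<^item> There remains the piece \<open>|t - x| \<le> |x| / 2\<close> for large \<open>x\<close>. Bounding it by absolute values gives
    \<open>1 / |x|\<close>, which just fails to be integrable. But there \<open>|t|\<close> has size \<open>|x|\<close>, and the derivative of the
    phase in \<open>t\<close> has size \<open>|x|\<^sup>\<delta>\<close>, with \<open>\<delta>\<close> one less than the highest exponent. Integration by parts
    gains \<open>|x|\<close> to the power \<open>- \<delta>\<close> at the cost of the supremum and the variation of \<open>F\<close> on
    \<open>|y| \<le> |x| / 2\<close>, which grow at most like \<open>|x|\<close> to the power \<open>\<sigma> = 1 - 1 / p\<close>. The outcome
    \<open>|x|\<close> to the power \<open>- 1 - (\<delta> - \<sigma>)\<close> is integrable exactly when \<open>\<delta> > \<sigma>\<close>: for all \<open>p\<close> when the highest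
    exponent exceeds \<open>2\<close>, and for finite \<open>p\<close> when the phase is quadratic.

  The identification of \<open>f\<close> with an indefinite integral is \<open>weak_derivative_imp_indefinite_integral\<close>,
  the gain from the phase is \<open>power_sum_phase_oscillation\<close>, the domination is
  \<open>maximal_average_pointwise\<close>, and its integration is \<open>osc_maximal_integral_bound\<close>.
\<close>

section \<open>Indefinite integrals\<close>

text \<open>Integration by parts where \<open>u\<close> is only an indefinite integral of \<open>g\<close>: writing
  \<open>u \<beta> - u t\<close> as the integral of \<open>g\<close> over \<open>{t..\<beta>}\<close> turns the difference of the two sides into a
  double integral of \<open>g s * e t\<close> over the triangle \<open>t \<le> s\<close>, and Fubini's theorem exchanges the order.
  It is used twice: against a test function, to identify weak derivatives, and against the
  oscillating factor of the maximal function.\<close>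

lemma set_integral_by_parts_indefinite:
  fixes u g e :: "real \<Rightarrow> complex"
  assumes g: "set_integrable lborel {\<alpha>..\<beta>} g" and e: "set_integrable lborel {\<alpha>..\<beta>} e"
    and le: "\<alpha> \<le> \<beta>"
    and u: "\<And>t. t \<in> {\<alpha>..\<beta>} \<Longrightarrow> u \<beta> - u t = (LINT s:{t..\<beta>}|lborel. g s)"
  shows "(LINT t:{\<alpha>..\<beta>}|lborel. u t * e t) =
    u \<beta> * (LINT t:{\<alpha>..\<beta>}|lborel. e t) - (LINT s:{\<alpha>..\<beta>}|lborel. g s * (LINT t:{\<alpha>..s}|lborel. e t))"
proof -
  define g' where "g' s = indicator {\<alpha>..\<beta>} s *\<^sub>R g s" for s
  define e' where "e' s = indicator {\<alpha>..\<beta>} s *\<^sub>R e s" for s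
  have ig: "integrable lborel g'" and ie: "integrable lborel e'"
    using g e by (auto simp: set_integrable_def g'_def[abs_def] e'_def[abs_def])
  note [measurable] = borel_measurable_integrable[OF ig] borel_measurable_integrable[OF ie]
  \<comment> \<open>The integrand on the triangle; the truncations make both orders of integration unrestricted.\<close>
  define k where "k s t = (if t \<le> s then g' s * e' t else 0)" for s t
  have ik: "integrable (lborel \<Otimes>\<^sub>M lborel) (\<lambda>(s, t). k s t)"
  proof (rule Bochner_Integration.integrable_bound)
    show "integrable (lborel \<Otimes>\<^sub>M lborel) (\<lambda>(s, t). g' s * e' t)"
    proof (rule lborel_pair.Fubini_integrable)
      show "integrable lborel (\<lambda>x. LINT y|lborel. cmod (case (x, y) of (s, t) \<Rightarrow> g' s * e' t))"
        using ig by (simp add: norm_mult)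
      show "AE x in lborel. integrable lborel (\<lambda>y. case (x, y) of (s, t) \<Rightarrow> g' s * e' t)"
        using ie by simp
    qed measurable
    show "(\<lambda>(s, t). k s t) \<in> borel_measurable (lborel \<Otimes>\<^sub>M lborel)"
      unfolding k_def by measurable
  qed (auto simp: k_def)
  have 1: "(LINT s|lborel. k s t) = (u \<beta> - u t) * e' t" for t
  proof (cases "t \<in> {\<alpha>..\<beta>}")
    case True
    have "k s t = (indicator {t..\<beta>} s *\<^sub>R g s) * e' t" for s
      using True by (auto simp: k_def g'_def indicator_def)
    then have "(LINT s|lborel. k s t) = (LINT s:{t..\<beta>}|lborel. g s) * e' t"
      unfolding set_lebesgue_integral_def by (simp only: integral_mult_left_zero)
    then show ?thesis using u[OF True] by simp
  next
    case False
    then have "e' t = 0" by (simp add: e'_def)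
    then have "k s t = 0" for s by (simp add: k_def)
    with \<open>e' t = 0\<close> show ?thesis by simp
  qed
  have 2: "(LINT t|lborel. k s t) = g' s * (LINT t:{\<alpha>..s}|lborel. e t)" for s
  proof (cases "s \<in> {\<alpha>..\<beta>}")
    case True
    have "k s t = g' s * (indicator {\<alpha>..s} t *\<^sub>R e t)" for t
      using True by (auto simp: k_def e'_def indicator_def)
    then show ?thesis unfolding set_lebesgue_integral_def by (simp only: integral_mult_right_zero)
  next
    case False
    then have "g' s = 0" by (simp add: g'_def)
    then have "k s t = 0" for t by (simp add: k_def)
    with \<open>g' s = 0\<close> show ?thesis by simp
  qed
  have int1: "integrable lborel (\<lambda>t. (u \<beta> - u t) * e' t)"
    using lborel_pair.integrable_snd[OF ik] by (simp add: 1)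
  have "(LINT t|lborel. (u \<beta> - u t) * e' t) = (LINT s|lborel. g' s * (LINT t:{\<alpha>..s}|lborel. e t))"
    using lborel_pair.Fubini_integral[OF ik] by (simp add: 1 2)
  moreover have "(LINT t|lborel. u t * e' t) = (LINT t|lborel. u \<beta> * e' t) - (LINT t|lborel. (u \<beta> - u t) * e' t)"
    by (subst Bochner_Integration.integral_diff[symmetric]) (use ie int1 in \<open>auto simp: algebra_simps\<close>)
  moreover have "(LINT t|lborel. u \<beta> * e' t) = u \<beta> * (LINT t|lborel. e' t)"
    by (rule integral_mult_right_zero)
  ultimately show ?thesis
    by (simp add: set_lebesgue_integral_def g'_def e'_def)
qed

text \<open>The half-lines \<open>{..a}\<close> generate the Borel sets and are stable under intersection, so a
  Dynkin system argument on each bounded window extends the vanishing from intervals to all Borel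
  sets.\<close>

lemma AE_eq_0_if_interval_integrals_eq_0:
  fixes v :: "real \<Rightarrow> 'b::{second_countable_topology, banach}"
  assumes int: "\<And>a b. set_integrable lborel {a..b} v"
    and zero: "\<And>a b. a \<le> b \<Longrightarrow> (LINT x:{a..b}|lborel. v x) = 0"
  shows "AE x in lborel. v x = 0"
proof -
  have "AE x in lborel. indicator {- real n..real n} x *\<^sub>R v x = 0" for n
  proof (rule sigma_finite_measure.density_zero[OF lborel.sigma_finite_measure_axioms])
    let ?v = "\<lambda>x. indicator {- real n..real n} x *\<^sub>R v x"
    show iv: "integrable lborel ?v"
      using int[of "- real n" "real n"] by (simp add: set_integrable_def)
    have i1: "integrable lborel (\<lambda>x. indicator A x *\<^sub>R ?v x)" if "A \<in> sets borel" for A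
      by (rule integrable_mult_indicator[OF _ iv]) (use that in simp)
    have tot: "(LINT x|lborel. ?v x) = 0"
      using zero[of "- real n" "real n"] by (simp add: set_lebesgue_integral_def)
    fix A :: "real set" assume "A \<in> sets lborel"
    then have "A \<in> sigma_sets UNIV (range (\<lambda>a. {..a::real}))"
      by (simp add: borel_eq_atMost)
    moreover have "Int_stable (range (\<lambda>a. {..a::real}))" "range (\<lambda>a. {..a::real}) \<subseteq> Pow UNIV"
      by (auto simp: Int_stable_def)
    ultimately have "Int_stable (range (\<lambda>a. {..a::real}))" "range (\<lambda>a. {..a::real}) \<subseteq> Pow UNIV"
      "A \<in> sigma_sets UNIV (range (\<lambda>a. {..a::real}))" by auto
    then show "set_lebesgue_integral lborel A ?v = 0"
      unfolding set_lebesgue_integral_def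
    proof (induction rule: sigma_sets_induct_disjoint)
      case (basic A)
      then obtain a where A: "A = {..a}" by auto
      show ?case
      proof (cases "- real n \<le> min a (real n)")
        case True
        have "indicator A x *\<^sub>R ?v x = indicator {- real n..min a (real n)} x *\<^sub>R v x" for x
          by (auto simp: A indicator_def)
        with zero[OF True] show ?thesis unfolding set_lebesgue_integral_def by (simp only:)
      next
        case False
        then have "indicator A x *\<^sub>R ?v x = 0" for x
          by (auto simp: A indicator_def)
        then show ?thesis by (simp only: integral_zero)
      qed
    next
      case empty then show ?case by simp
    next
      case (compl A)
      then have A: "A \<in> sets borel" by (simp add: borel_eq_atMost)
      have "(LINT x|lborel. indicator (UNIV - A) x *\<^sub>R ?v x)
          = (LINT x|lborel. ?v x - indicator A x *\<^sub>R ?v x)"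
        by (intro Bochner_Integration.integral_cong) (auto simp: indicator_def)
      then show ?case
        using compl.IH tot iv i1[OF A] by (subst (asm) Bochner_Integration.integral_diff) auto
    next
      case (union A)
      then have A: "A i \<in> sets borel" for i by (auto simp: borel_eq_atMost)
      have "set_lebesgue_integral lborel (\<Union>i. A i) ?v = (\<Sum>i. set_lebesgue_integral lborel (A i) ?v)"
      proof (rule lebesgue_integral_countable_add)
        show "set_integrable lborel (\<Union> (range A)) ?v"
          unfolding set_integrable_def by (rule i1) (use A in auto)
        show "i \<noteq> j \<Longrightarrow> A i \<inter> A j = {}" for i j
          using union(1) by (auto simp: disjoint_family_on_def)
      qed (use A in auto)
      then show ?case using union by (simp add: set_lebesgue_integral_def)
    qed
  qed
  then have "AE x in lborel. \<forall>n. indicator {- real n..real n} x *\<^sub>R v x = 0"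
    unfolding AE_all_countable by blast
  then show ?thesis
  proof eventually_elim
    case (elim x)
    obtain n where "\<bar>x\<bar> \<le> real n" using real_arch_simple by blast
    with elim[rule_format, of n] show ?case by (auto simp: indicator_def)
  qed
qed

section \<open>Explicit test functions\<close>

text \<open>The functions \<open>P (1 / x) exp (- 1 / x)\<close>, extended by \<open>0\<close> to \<open>x \<le> 0\<close>. Allowing a polynomial
  factor makes the family closed under differentiation, which gives smoothness without computing
  any higher derivative.\<close>

definition flat_exp :: "real poly \<Rightarrow> real \<Rightarrow> real" where
  "flat_exp P x = (if 0 < x then poly P (1 / x) * exp (- (1 / x)) else 0)"

lemma poly_times_exp_minus_tendsto_0:
  fixes P :: "real poly"
  shows "((\<lambda>y. poly P y * exp (- y)) \<longlongrightarrow> 0) at_top"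
proof -
  have "((\<lambda>y::real. \<Sum>i\<le>degree P. coeff P i * (y ^ i / exp y)) \<longlongrightarrow> (\<Sum>i\<le>degree P. coeff P i * 0)) at_top"
    by (intro tendsto_intros tendsto_power_div_exp_0)
  then show ?thesis
    by (simp add: poly_altdef exp_minus sum_distrib_right divide_inverse mult.assoc)
qed

lemma flat_exp_deriv:
  "(flat_exp P has_real_derivative flat_exp ([:0, 0, 1:] * (P - pderiv P)) x) (at x)"
proof -
  consider "x < 0" | "x = 0" | "0 < x" by linarith
  then show ?thesis
  proof cases
    case 1
    have "((\<lambda>_. 0) has_real_derivative 0) (at x)" by simp
    then have "(flat_exp P has_real_derivative 0) (at x)"
      by (rule has_field_derivative_transform_within_open[of _ _ _ "{..<0}"])
        (use 1 in \<open>auto simp: flat_exp_def\<close>)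
    then show ?thesis using 1 by (simp add: flat_exp_def)
  next
    case 3
    have "((\<lambda>x. poly P (1 / x) * exp (- (1 / x))) has_real_derivative
       poly P (1 / x) * (exp (- (1 / x)) * (1 / x^2)) + poly (pderiv P) (1 / x) * (- (1 / x^2)) * exp (- (1 / x))) (at x)"
      using 3 by (auto intro!: derivative_eq_intros DERIV_chain'[OF _ poly_DERIV] simp: power2_eq_square)
    moreover have "eventually (\<lambda>y. 0 < y) (nhds x)"
      using 3 eventually_nhds_in_open[of "{0<..}" x] by auto
    then have "eventually (\<lambda>y. flat_exp P y = poly P (1 / y) * exp (- (1 / y))) (nhds x)"
      by eventually_elim (simp add: flat_exp_def)
    ultimately show ?thesis using 3
      by (subst DERIV_cong_ev[OF refl _ refl]) (auto simp: flat_exp_def field_simps power2_eq_square)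
  next
    case 2
    have "((\<lambda>h. (flat_exp P (0 + h) - flat_exp P 0) / h) \<longlongrightarrow> 0) (at 0)"
    proof (rule filterlim_split_at_real)
      show "((\<lambda>h. (flat_exp P (0 + h) - flat_exp P 0) / h) \<longlongrightarrow> 0) (at_left 0)"
        by (rule tendsto_eventually) (auto simp: eventually_at_filter flat_exp_def)
      have "((\<lambda>h. poly (pCons 0 P) (inverse h) * exp (- inverse h)) \<longlongrightarrow> 0) (at_right (0::real))"
        by (rule filterlim_compose[OF poly_times_exp_minus_tendsto_0 filterlim_inverse_at_top_right])
      then show "((\<lambda>h. (flat_exp P (0 + h) - flat_exp P 0) / h) \<longlongrightarrow> 0) (at_right 0)"
        by (rule Lim_transform_eventually)
          (auto simp: eventually_at_filter flat_exp_def field_simps)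
    qed
    then show ?thesis using 2 by (simp add: DERIV_def flat_exp_def)
  qed
qed

text \<open>Sums of products of a flat function of \<open>x - p\<close> and one of \<open>q - x\<close>. By the product rule this
  class is again closed under differentiation, so all its members are smooth.\<close>

inductive bump_sum :: "(real \<Rightarrow> real) \<Rightarrow> bool" where
  base: "bump_sum (\<lambda>x. c * flat_exp P (k * (x - p)) * flat_exp Q (k * (q - x)))"
| add: "bump_sum f \<Longrightarrow> bump_sum g \<Longrightarrow> bump_sum (\<lambda>x. f x + g x)"

lemma bump_sum_has_derivative:
  "bump_sum f \<Longrightarrow> \<exists>f'. bump_sum f' \<and> (\<forall>x. (f has_real_derivative f' x) (at x))"
proof (induction rule: bump_sum.induct)
  case (base c P k p Q q)
  let ?D = "\<lambda>P. [:0, 0, 1:] * (P - pderiv P)"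
  have "((\<lambda>x. c * flat_exp P (k * (x - p)) * flat_exp Q (k * (q - x))) has_real_derivative
      (c * k) * flat_exp (?D P) (k * (x - p)) * flat_exp Q (k * (q - x)) +
      (- c * k) * flat_exp P (k * (x - p)) * flat_exp (?D Q) (k * (q - x))) (at x)" for x
    by (rule derivative_eq_intros DERIV_chain'[OF _ flat_exp_deriv] refl)+ (simp add: algebra_simps)
  then show ?case
    by (intro exI[of _ "\<lambda>x. (c * k) * flat_exp (?D P) (k * (x - p)) * flat_exp Q (k * (q - x)) +
      (- c * k) * flat_exp P (k * (x - p)) * flat_exp (?D Q) (k * (q - x))"] conjI bump_sum.intros allI)
next
  case (add f g)
  then obtain f' g' where "bump_sum f'" "\<forall>x. (f has_real_derivative f' x) (at x)"
      "bump_sum g'" "\<forall>x. (g has_real_derivative g' x) (at x)" by blast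
  then show ?case
    by (intro exI[of _ "\<lambda>x. f' x + g' x"]) (auto intro: bump_sum.add DERIV_add)
qed

lemma bump_sum_funpow_deriv: "bump_sum f \<Longrightarrow> bump_sum ((deriv ^^ n) f)"
proof (induction n)
  case (Suc n)
  then obtain f' where f': "bump_sum f'" "\<forall>x. ((deriv ^^ n) f has_real_derivative f' x) (at x)"
    using bump_sum_has_derivative by blast
  then have "(deriv ^^ Suc n) f = f'"
    by (auto intro: DERIV_imp_deriv)
  with f' show ?case by simp
qed simp

lemma bump_sum_differentiable: "bump_sum f \<Longrightarrow> f differentiable_on UNIV"
  using bump_sum_has_derivative[of f]
  by (force simp: differentiable_on_def real_differentiable_def)

lemma bump_sum_continuous: "bump_sum f \<Longrightarrow> continuous_on A f"
  using bump_sum_differentiable differentiable_imp_continuous_on continuous_on_subset by blast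

text \<open>The condition of mean zero is what makes an antiderivative vanish on both sides of the
  support, hence a test function itself.\<close>

lemma test_function_antiderivative:
  assumes \<psi>: "bump_sum \<psi>" and ab: "a \<le> b"
    and supp: "\<And>x. x \<notin> {a..b} \<Longrightarrow> \<psi> x = 0" and mean: "(LBINT x:{a..b}. \<psi> x) = 0"
  shows "\<exists>\<phi>. test_function \<phi> \<and> (\<forall>x. (\<phi> has_real_derivative \<psi> x) (at x)) \<and> (\<forall>x. x \<notin> {a..b} \<longrightarrow> \<phi> x = 0)"
proof -
  have "isCont \<psi> x" for x
    using bump_sum_continuous[OF \<psi>, of UNIV] by (simp add: continuous_on_eq_continuous_at)
  then obtain F where F: "\<And>x. (F has_vector_derivative \<psi> x) (at x)"
    using einterval_antiderivative[of "-\<infinity>" \<infinity> \<psi>] by auto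
  define \<phi> where "\<phi> x = F x - F a" for x
  have d: "(\<phi> has_real_derivative \<psi> x) (at x)" for x
    using DERIV_diff[OF F[of x, folded has_real_derivative_iff_has_vector_derivative] DERIV_const[of "F a"]]
    by (simp add: \<phi>_def[abs_def])
  have cont: "continuous_on A \<phi>" for A
    using d by (meson DERIV_isCont continuous_at_imp_continuous_on)
  have "(LBINT x=a..b. \<psi> x) = F b - F a"
    by (rule interval_integral_FTC_finite)
      (use ab F bump_sum_continuous[OF \<psi>] in \<open>auto intro: has_vector_derivative_at_within\<close>)
  then have Fba: "F b = F a"
    using mean ab by (simp add: interval_integral_Icc)
  have out: "\<phi> x = 0" if "x \<notin> {a..b}" for x
  proof (cases "x < a")
    case True
    have "\<phi> x = \<phi> a"
    proof (rule DERIV_isconst_end[symmetric, OF True])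
      show "continuous_on {x..a} \<phi>" by (rule cont)
      show "DERIV \<phi> y :> 0" if "x < y" "y < a" for y
        using d[of y] supp[of y] that by simp
    qed
    then show ?thesis by (simp add: \<phi>_def)
  next
    case False
    with that have bx: "b < x" by auto
    have "\<phi> x = \<phi> b"
    proof (rule DERIV_isconst_end[OF bx])
      show "continuous_on {b..x} \<phi>" by (rule cont)
      show "DERIV \<phi> y :> 0" if "b < y" "y < x" for y
        using d[of y] supp[of y] that by simp
    qed
    then show ?thesis using Fba by (simp add: \<phi>_def)
  qed
  have "(deriv ^^ n) \<phi> differentiable_on UNIV" for n
  proof (cases n)
    case 0
    then show ?thesis using d by (force simp: differentiable_on_def real_differentiable_def)
  next
    case (Suc m)
    have "deriv \<phi> = \<psi>" using d by (auto intro: DERIV_imp_deriv)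
    then have "(deriv ^^ n) \<phi> = (deriv ^^ m) \<psi>" by (simp add: Suc funpow_Suc_right del: funpow.simps)
    then show ?thesis using bump_sum_funpow_deriv[OF \<psi>] bump_sum_differentiable by simp
  qed
  moreover have "closure {x. \<phi> x \<noteq> 0} \<subseteq> {a..b}"
    using out by (intro closure_minimal subsetI) blast+
  then have "compact (closure {x. \<phi> x \<noteq> 0})"
    by (meson bounded_closed_interval bounded_subset closed_closure compact_eq_bounded_closed)
  ultimately show ?thesis using d out by (auto simp: test_function_def)
qed

section \<open>Functions with a weak derivative are indefinite integrals\<close>

text \<open>As \<open>n\<close> grows these bumps increase to the indicator of the open interval, since the
  exponents \<open>1 / (Suc n * (x - a))\<close> and \<open>1 / (Suc n * (b - x))\<close> tend to \<open>0\<close> inside it.\<close>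

definition bump :: "nat \<Rightarrow> real \<Rightarrow> real \<Rightarrow> real \<Rightarrow> real" where
  "bump n a b x = flat_exp 1 (real (Suc n) * (x - a)) * flat_exp 1 (real (Suc n) * (b - x))"

lemma bump_eq:
  "bump n a b x = (if x \<in> {a<..<b} then exp (- (1 / (real (Suc n) * (x - a)))) * exp (- (1 / (real (Suc n) * (b - x)))) else 0)"
  by (auto simp: bump_def flat_exp_def zero_less_mult_iff)

lemma bump_nonneg: "0 \<le> bump n a b x" and bump_le_1: "bump n a b x \<le> 1"
proof -
  show "0 \<le> bump n a b x" by (simp add: bump_eq)
  show "bump n a b x \<le> 1"
    unfolding bump_eq by (auto intro!: mult_le_one)
qed

lemma norm_bump_scaleR_le: "norm (bump n a b x *\<^sub>R z) \<le> norm z"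
  using bump_le_1[of n a b x] by (simp add: mult_left_le_one_le bump_nonneg)

lemma bump_continuous: "continuous_on A (bump n a b)"
proof -
  have "bump_sum (\<lambda>x. 1 * flat_exp 1 (real (Suc n) * (x - a)) * flat_exp 1 (real (Suc n) * (b - x)))"
    by (rule bump_sum.base)
  from bump_sum_continuous[OF this] show ?thesis by (simp add: bump_def[abs_def])
qed

lemma bump_measurable [measurable]: "bump n a b \<in> borel_measurable borel"
  by (intro borel_measurable_continuous_onI bump_continuous)

lemma integrable_bump_scaleR:
  fixes v :: "real \<Rightarrow> 'b::{banach, second_countable_topology}"
  assumes "set_integrable lborel {a..b} v"
  shows "integrable lborel (\<lambda>x. bump n a b x *\<^sub>R v x)"
proof -
  let ?v = "\<lambda>x. indicator {a..b} x *\<^sub>R v x"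
  have v: "integrable lborel ?v" using assms by (simp add: set_integrable_def)
  note [measurable] = borel_measurable_integrable[OF v]
  have eq: "bump n a b x *\<^sub>R v x = bump n a b x *\<^sub>R ?v x" for x
    by (simp add: bump_eq indicator_def)
  show ?thesis unfolding eq
  proof (rule Bochner_Integration.integrable_bound[OF v])
    show "AE x in lborel. norm (bump n a b x *\<^sub>R ?v x) \<le> norm (?v x)"
      by (rule AE_I2) (rule norm_bump_scaleR_le)
  qed measurable
qed

lemma bump_tendsto_indicator:
  fixes v :: "real \<Rightarrow> 'b::{banach, second_countable_topology}"
  assumes "set_integrable lborel {a..b} v"
  shows "(\<lambda>n. LINT x|lborel. bump n a b x *\<^sub>R v x) \<longlonglongrightarrow> (LINT x:{a..b}|lborel. v x)"
proof -
  let ?v = "\<lambda>x. indicator {a..b} x *\<^sub>R v x"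
  have v: "integrable lborel ?v" using assms by (simp add: set_integrable_def)
  note [measurable] = borel_measurable_integrable[OF v]
  have eq: "bump n a b x *\<^sub>R v x = bump n a b x *\<^sub>R ?v x" for n x
    by (simp add: bump_eq indicator_def)
  show ?thesis unfolding eq set_lebesgue_integral_def
  proof (rule integral_dominated_convergence)
    show "integrable lborel (\<lambda>x. norm (?v x))" by (rule integrable_norm[OF v])
    show "AE x in lborel. (\<lambda>n. bump n a b x *\<^sub>R ?v x) \<longlonglongrightarrow> ?v x"
      using AE_lborel_singleton[of a] AE_lborel_singleton[of b]
    proof eventually_elim
      case (elim x)
      show ?case
      proof (cases "x \<in> {a<..<b}")
        case True
        have lim: "(\<lambda>n. exp (- (1 / (real (Suc n) * c)))) \<longlonglongrightarrow> exp (- 0)" if "0 < c" for c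
        proof (intro tendsto_intros tendsto_divide_0[OF tendsto_const])
          show "filterlim (\<lambda>n. real (Suc n) * c) at_infinity sequentially"
            by (intro filterlim_at_top_imp_at_infinity filterlim_at_top_mult_tendsto_pos[OF tendsto_const that]
                filterlim_compose[OF filterlim_real_sequentially filterlim_Suc])
        qed
        have "(\<lambda>n. bump n a b x) \<longlonglongrightarrow> exp (- 0) * exp (- 0)"
          unfolding bump_eq using True by (simp only: if_True) (intro tendsto_mult lim; simp)
        from tendsto_scaleR[OF this tendsto_const[of "?v x"]] show ?thesis by simp
      next
        case False
        with elim have "?v x = 0" by (auto simp: indicator_def)
        then show ?thesis by (simp only: scaleR_zero_right tendsto_const)
      qed
    qed
    show "AE x in lborel. norm (bump n a b x *\<^sub>R ?v x) \<le> norm (?v x)" for n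
      by (rule AE_I2) (rule norm_bump_scaleR_le)
  qed measurable
qed

text \<open>A mean-zero combination of the bumps on \<open>[p, q]\<close> and on \<open>[0, 1]\<close> is the derivative of a
  test function. Letting the bumps tend to indicators shows that the integral of \<open>v\<close> over \<open>[p, q]\<close>
  is \<open>q - p\<close> times its integral over \<open>[0, 1]\<close>, so \<open>v\<close> minus that constant integrates to zero over
  every interval.\<close>

lemma du_bois_reymond:
  fixes v :: "real \<Rightarrow> complex"
  assumes int: "\<And>a b. set_integrable lborel {a..b} v"
    and zero: "\<And>\<phi> \<psi> a b. \<lbrakk>test_function \<phi>; \<And>x. (\<phi> has_real_derivative \<psi> x) (at x); continuous_on UNIV \<psi>; a \<le> b;
        \<And>x. x \<notin> {a..b} \<Longrightarrow> \<phi> x = 0; \<And>x. x \<notin> {a..b} \<Longrightarrow> \<psi> x = 0\<rbrakk>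
      \<Longrightarrow> (LINT x|lborel. \<psi> x *\<^sub>R v x) = 0"
  shows "\<exists>c. AE x in lborel. v x = c"
proof -
  define c where "c = (LINT x:{0..1}|lborel. v x)"
  define m where "m n p q = (LINT x|lborel. bump n p q x)" for n p q
  have one: "set_integrable lborel {p..q::real} (\<lambda>_. 1::real)" for p q
    by (intro borel_integrable_atLeastAtMost') simp
  have bi: "integrable lborel (bump n p q)" for n p q
    using integrable_bump_scaleR[OF one, of n p q] by simp
  have m: "(\<lambda>n. m n p q) \<longlonglongrightarrow> q - p" if "p \<le> q" for p q
    using bump_tendsto_indicator[OF one, of p q] that
    by (simp add: m_def set_lebesgue_integral_def)
  have mean: "(LINT x:{p..q}|lborel. v x) = (q - p) *\<^sub>R c" if pq: "p \<le> q" for p q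
  proof -
    \<comment> \<open>Test against the combination of the bumps on \<open>[p, q]\<close> and \<open>[0, 1]\<close> that has mean zero.\<close>
    have eq: "m n 0 1 *\<^sub>R (LINT x|lborel. bump n p q x *\<^sub>R v x) = m n p q *\<^sub>R (LINT x|lborel. bump n 0 1 x *\<^sub>R v x)" for n
    proof -
      define \<psi> where "\<psi> x = m n 0 1 * bump n p q x + (- m n p q) * bump n 0 1 x" for x
      define a b where "a = min p 0" and "b = max q 1"
      have ab: "a \<le> b" by (simp add: a_def b_def)
      have bs: "bump_sum \<psi>"
        unfolding \<psi>_def[abs_def] bump_def mult.assoc[symmetric]
        by (intro bump_sum.intros)
      have supp: "\<psi> x = 0" if "x \<notin> {a..b}" for x
        using that by (auto simp: \<psi>_def bump_eq a_def b_def)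
      have "(LBINT x:{a..b}. \<psi> x) = (LINT x|lborel. \<psi> x)"
        unfolding set_lebesgue_integral_def
        by (intro Bochner_Integration.integral_cong refl) (use supp in \<open>auto simp: indicator_def\<close>)
      also have "\<dots> = 0"
        using bi by (simp add: \<psi>_def m_def)
      finally obtain \<phi> where \<phi>: "test_function \<phi>" "\<And>x. (\<phi> has_real_derivative \<psi> x) (at x)"
          "\<And>x. x \<notin> {a..b} \<Longrightarrow> \<phi> x = 0"
        using test_function_antiderivative[OF bs ab supp] by blast
      have "0 = (LINT x|lborel. \<psi> x *\<^sub>R v x)"
        by (rule sym, rule zero[OF \<phi>(1,2) bump_sum_continuous[OF bs] ab \<phi>(3) supp])
      also have "\<dots> =
          (LINT x|lborel. m n 0 1 *\<^sub>R (bump n p q x *\<^sub>R v x) - m n p q *\<^sub>R (bump n 0 1 x *\<^sub>R v x))"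
        by (intro Bochner_Integration.integral_cong) (auto simp: \<psi>_def algebra_simps)
      also have "\<dots> = m n 0 1 *\<^sub>R (LINT x|lborel. bump n p q x *\<^sub>R v x) - m n p q *\<^sub>R (LINT x|lborel. bump n 0 1 x *\<^sub>R v x)"
        by (subst Bochner_Integration.integral_diff; (intro integrable_scaleR_right integrable_bump_scaleR int)?)
          (simp only: integral_scaleR_right)
      finally show ?thesis by simp
    qed
    have "(\<lambda>n. m n 0 1 *\<^sub>R (LINT x|lborel. bump n p q x *\<^sub>R v x)) \<longlonglongrightarrow> (1 - 0) *\<^sub>R (LINT x:{p..q}|lborel. v x)"
      by (intro tendsto_scaleR m bump_tendsto_indicator int) simp
    moreover have "(\<lambda>n. m n p q *\<^sub>R (LINT x|lborel. bump n 0 1 x *\<^sub>R v x)) \<longlonglongrightarrow> (q - p) *\<^sub>R c"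
      unfolding c_def by (intro tendsto_scaleR m bump_tendsto_indicator int pq)
    ultimately show ?thesis unfolding eq by (auto dest: LIMSEQ_unique)
  qed
  have ci: "set_integrable lborel {a..b} (\<lambda>_. c)" for a b :: real
    by (intro borel_integrable_atLeastAtMost') simp
  have "AE x in lborel. v x - c = 0"
  proof (rule AE_eq_0_if_interval_integrals_eq_0)
    show "set_integrable lborel {a..b} (\<lambda>x. v x - c)" for a b
      by (intro set_integral_diff int ci)
    show "(LINT x:{a..b}|lborel. v x - c) = 0" if "a \<le> b" for a b
      using that by (subst set_integral_diff(2)[OF int ci])
        (simp add: mean set_lebesgue_integral_def[of _ _ "\<lambda>_. c"])
  qed
  then show ?thesis by auto
qed

lemma borel_measurable_imp_lebesgue:
  "k \<in> borel_measurable borel \<Longrightarrow> k \<in> borel_measurable lebesgue"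
  by (intro measurable_completion) (simp only: measurable_lborel2)

lemma ex_borel_version_complex:
  fixes f :: "real \<Rightarrow> complex"
  assumes "f \<in> borel_measurable lebesgue"
  shows "\<exists>f'\<in>borel_measurable borel. AE x in lborel. f x = f' x"
proof -
  have "(\<lambda>x. Re (f x)) \<in> borel_measurable lebesgue" "(\<lambda>x. Im (f x)) \<in> borel_measurable lebesgue"
    using assms by measurable
  then obtain a b where [measurable]: "a \<in> borel_measurable borel" "b \<in> borel_measurable borel"
    and ae: "AE x in lborel. Re (f x) = a x" "AE x in lborel. Im (f x) = b x"
    using completion_ex_borel_measurable_real[of "\<lambda>x. Re (f x)" lborel]
      completion_ex_borel_measurable_real[of "\<lambda>x. Im (f x)" lborel] by auto
  show ?thesis
  proof (intro bexI[of _ "\<lambda>x. complex_of_real (a x) + \<i> * complex_of_real (b x)"])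
    show "AE x in lborel. f x = complex_of_real (a x) + \<i> * complex_of_real (b x)"
      using ae by eventually_elim (simp add: complex_eq_iff)
  qed measurable
qed

lemma locally_integrable_measurable:
  assumes "locally_integrable f"
  shows "f \<in> borel_measurable lebesgue"
proof (rule borel_measurable_LIMSEQ_metric)
  show "(\<lambda>x. indicator {- real n..real n} x *\<^sub>R f x) \<in> borel_measurable lebesgue" for n
  proof -
    have "integrable lebesgue (\<lambda>x. indicator {- real n..real n} x *\<^sub>R f x)"
      using assms by (simp add: locally_integrable_def set_integrable_def)
    then show ?thesis by (rule borel_measurable_integrable)
  qed
  show "(\<lambda>n. indicator {- real n..real n} x *\<^sub>R f x) \<longlonglongrightarrow> f x" for x
  proof (rule tendsto_eventually)
    have "\<forall>\<^sub>F n in sequentially. \<bar>x\<bar> \<le> real n"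
      using eventually_ge_at_top[of "nat \<lceil>\<bar>x\<bar>\<rceil>"] by eventually_elim linarith
    then show "\<forall>\<^sub>F n in sequentially. indicator {- real n..real n} x *\<^sub>R f x = f x"
      by eventually_elim (auto simp: indicator_def)
  qed
qed

lemma locally_integrable_borel_version:
  assumes "locally_integrable f"
  shows "\<exists>f'\<in>borel_measurable borel. (AE x in lborel. f x = f' x) \<and> (\<forall>a b. set_integrable lborel {a..b} f')"
proof -
  obtain f' where f' [measurable]: "f' \<in> borel_measurable borel" and ae: "AE x in lborel. f x = f' x"
    using ex_borel_version_complex[OF locally_integrable_measurable[OF assms]] by blast
  note f_leb = locally_integrable_measurable[OF assms]
  have f'_leb: "f' \<in> borel_measurable lebesgue"
    using f' by (rule borel_measurable_imp_lebesgue)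
  have "set_integrable lborel {a..b} f'" for a b
  proof -
    have "integrable lebesgue (\<lambda>x. indicator {a..b} x *\<^sub>R f x)"
      using assms by (simp add: locally_integrable_def set_integrable_def)
    also have "?this \<longleftrightarrow> integrable lebesgue (\<lambda>x. indicator {a..b} x *\<^sub>R f' x)"
    proof (rule integrable_cong_AE)
      show "AE x in lebesgue. indicator {a..b} x *\<^sub>R f x = indicator {a..b} x *\<^sub>R f' x"
        using AE_completion[OF ae] by eventually_elim simp
      have "{a..b} \<in> sets lebesgue" by simp
      then have [measurable]: "(indicator {a..b} :: real \<Rightarrow> real) \<in> borel_measurable lebesgue"
        by (rule borel_measurable_indicator)
      show "(\<lambda>x. indicator {a..b} x *\<^sub>R f x) \<in> borel_measurable lebesgue"
           "(\<lambda>x. indicator {a..b} x *\<^sub>R f' x) \<in> borel_measurable lebesgue"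
        using f_leb f'_leb \<open>indicator {a..b} \<in> borel_measurable lebesgue\<close> by (auto intro!: borel_measurable_scaleR)
    qed
    also have "\<dots> \<longleftrightarrow> integrable lborel (\<lambda>x. indicator {a..b} x *\<^sub>R f' x)"
      by (rule integrable_completion) measurable
    finally show ?thesis by (simp add: set_integrable_def)
  qed
  with f' ae show ?thesis by blast
qed

lemma continuous_indefinite_integral:
  fixes F G :: "real \<Rightarrow> complex"
  assumes G: "\<And>a b. set_integrable lborel {a..b} G"
    and F: "\<And>x y. x \<le> y \<Longrightarrow> F y - F x = (LINT s:{x..y}|lborel. G s)"
  shows "continuous_on UNIV F"
proof -
  have "isCont F x" for x
  proof -
    let ?a = "x - 1" let ?b = "x + 1"
    have "G integrable_on {?a..?b}"
      using set_borel_integral_eq_integral(1)[OF G] .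
    then have "continuous_on {?a..?b} (\<lambda>y. integral {?a..y} G)"
      by (rule indefinite_integral_continuous_1)
    then have "continuous_on {?a..?b} (\<lambda>y. F ?a + integral {?a..y} G)"
      by (intro continuous_intros)
    also have "?this \<longleftrightarrow> continuous_on {?a..?b} F"
    proof (rule continuous_on_cong[OF refl])
      fix y assume "y \<in> {?a..?b}"
      then show "F ?a + integral {?a..y} G = F y"
        using F[of ?a y] set_borel_integral_eq_integral(2)[OF G[of ?a y]] by (simp add: algebra_simps)
    qed
    finally have "continuous_on {?a<..<?b} F" by (rule continuous_on_subset) auto
    then show ?thesis by (simp add: continuous_on_eq_continuous_at)
  qed
  then show ?thesis by (simp add: continuous_at_imp_continuous_on)
qed

lemma ex_indefinite_integral:
  fixes G :: "real \<Rightarrow> complex"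
  assumes G: "\<And>a b. set_integrable lborel {a..b} G"
  shows "\<exists>H. \<forall>x y. x \<le> y \<longrightarrow> H y - H x = (LINT s:{x..y}|lborel. G s)"
proof -
  define H where "H x = (LBINT s=0..ereal x. G s)" for x :: real
  have "H y - H x = (LINT s:{x..y}|lborel. G s)" if "x \<le> y" for x y
  proof -
    let ?a = "min 0 x" and ?b = "max 0 y"
    have ab: "?a \<le> ?b" by simp
    have "set_integrable lborel {?a<..<?b} G"
      by (rule set_integrable_subset[OF G[of ?a ?b]]) auto
    then have "interval_lebesgue_integrable lborel (ereal ?a) (ereal ?b) G"
      unfolding interval_lebesgue_integrable_def using ab by (simp del: ereal_min ereal_max min.bounded_iff)
    moreover have "min (ereal 0) (min (ereal x) (ereal y)) = ereal ?a" "max (ereal 0) (max (ereal x) (ereal y)) = ereal ?b"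
      using that by (auto simp: min_def max_def)
    ultimately have "(LBINT s=ereal 0..ereal x. G s) + (LBINT s=ereal x..ereal y. G s) = (LBINT s=ereal 0..ereal y. G s)"
      by (intro interval_integral_sum) metis
    then show ?thesis using that by (simp add: H_def interval_integral_Icc zero_ereal_def algebra_simps)
  qed
  then show ?thesis by blast
qed

lemma set_integrable_mult_continuous:
  fixes v :: "real \<Rightarrow> complex" and \<psi> :: "real \<Rightarrow> real"
  assumes v: "set_integrable lborel {a..b} v" and \<psi>: "continuous_on UNIV \<psi>"
  shows "set_integrable lborel {a..b} (\<lambda>x. \<psi> x *\<^sub>R v x)"
proof -
  have [measurable]: "\<psi> \<in> borel_measurable borel" using \<psi> by (rule borel_measurable_continuous_onI)
  have vi: "integrable lborel (\<lambda>x. indicator {a..b} x *\<^sub>R v x)" using v by (simp add: set_integrable_def)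
  note [measurable] = borel_measurable_integrable[OF vi]
  have "compact (\<psi> ` {a..b})" by (intro compact_continuous_image continuous_on_subset[OF \<psi>]) auto
  then obtain B where B: "\<And>x. x \<in> {a..b} \<Longrightarrow> \<bar>\<psi> x\<bar> \<le> B"
    using compact_imp_bounded bounded_iff by (metis imageI real_norm_def)
  have "integrable lborel (\<lambda>x. \<psi> x *\<^sub>R (indicator {a..b} x *\<^sub>R v x))"
  proof (rule Bochner_Integration.integrable_bound)
    show "integrable lborel (\<lambda>x. B *\<^sub>R (indicator {a..b} x *\<^sub>R v x))"
      by (rule integrable_scaleR_right[OF vi])
    show "AE x in lborel. norm (\<psi> x *\<^sub>R (indicator {a..b} x *\<^sub>R v x)) \<le> norm (B *\<^sub>R (indicator {a..b} x *\<^sub>R v x))"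
    proof (rule AE_I2)
      fix x
      show "norm (\<psi> x *\<^sub>R (indicator {a..b} x *\<^sub>R v x)) \<le> norm (B *\<^sub>R (indicator {a..b} x *\<^sub>R v x))"
      proof (cases "x \<in> {a..b}")
        case True
        with B[OF True] show ?thesis by (simp add: mult_right_mono)
      qed simp
    qed
  qed measurable
  then show ?thesis by (simp add: set_integrable_def mult.commute)
qed

text \<open>Both \<open>f\<close> and a primitive \<open>H\<close> of its weak derivative have the same integrals against
  derivatives of test functions, the latter by integration by parts; hence they differ by a
  constant. The Borel representative \<open>G\<close> keeps all later product measures within the Borel sets.\<close>

lemma weak_derivative_imp_indefinite_integral:
  assumes "has_weak_derivative f g"
  obtains F G where "G \<in> borel_measurable borel" "\<And>a b. set_integrable lborel {a..b} G"
    "AE x in lborel. f x = F x" "AE x in lborel. g x = G x"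
    "\<And>x y. x \<le> y \<Longrightarrow> F y - F x = (LINT s:{x..y}|lborel. G s)"
proof -
  have lf: "locally_integrable f" and lg: "locally_integrable g"
    and wd: "\<And>\<phi>. test_function \<phi> \<Longrightarrow> (LINT x|lebesgue. deriv \<phi> x *\<^sub>R f x) = - (LINT x|lebesgue. \<phi> x *\<^sub>R g x)"
    using assms by (auto simp: has_weak_derivative_def)
  note [measurable] = locally_integrable_measurable[OF lf] locally_integrable_measurable[OF lg]
  obtain f0 where [measurable]: "f0 \<in> borel_measurable borel" and f0: "AE x in lborel. f x = f0 x"
      "\<And>a b. set_integrable lborel {a..b} f0"
    using locally_integrable_borel_version[OF lf] by blast
  obtain G where [measurable]: "G \<in> borel_measurable borel" and G: "AE x in lborel. g x = G x"
      "\<And>a b. set_integrable lborel {a..b} G"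
    using locally_integrable_borel_version[OF lg] by blast
  obtain H where H: "\<And>x y. x \<le> y \<Longrightarrow> H y - H x = (LINT s:{x..y}|lborel. G s)"
    using ex_indefinite_integral[OF G(2)] by blast
  have Hc: "continuous_on UNIV H" by (rule continuous_indefinite_integral[OF G(2) H])
  have Hi: "set_integrable lborel {a..b} H" for a b
    by (intro borel_integrable_atLeastAtMost' continuous_on_subset[OF Hc]) auto
  have [measurable]: "H \<in> borel_measurable borel"
    using Hc by (rule borel_measurable_continuous_onI)
  have "\<exists>c. AE x in lborel. f0 x - H x = c"
  proof (rule du_bois_reymond)
    show "set_integrable lborel {a..b} (\<lambda>x. f0 x - H x)" for a b
      by (intro set_integral_diff f0 Hi)
    fix \<phi> \<psi> a b
    assume \<phi>: "test_function \<phi>" "\<And>x. (\<phi> has_real_derivative \<psi> x) (at x)" "continuous_on UNIV \<psi>" "a \<le> b"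
      and supp: "\<And>x. x \<notin> {a..b} \<Longrightarrow> \<phi> x = 0" "\<And>x. x \<notin> {a..b} \<Longrightarrow> \<psi> x = 0"
    have \<phi>c: "continuous_on UNIV \<phi>" using \<phi>(2) by (meson DERIV_isCont continuous_at_imp_continuous_on)
    have [measurable]: "\<psi> \<in> borel_measurable borel" "\<phi> \<in> borel_measurable borel"
      using \<phi>(3) \<phi>c by (auto intro: borel_measurable_continuous_onI)
    have d: "deriv \<phi> = \<psi>" using \<phi>(2) by (auto intro: DERIV_imp_deriv)
    have [measurable]: "\<psi> \<in> borel_measurable lebesgue" "\<phi> \<in> borel_measurable lebesgue"
      "f0 \<in> borel_measurable lebesgue" "G \<in> borel_measurable lebesgue"
      by (rule borel_measurable_imp_lebesgue, measurable)+
    have "(LINT x|lborel. \<psi> x *\<^sub>R f0 x) = (LINT x|lebesgue. \<psi> x *\<^sub>R f0 x)"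
      by (rule integral_completion[symmetric]) measurable
    also have "\<dots> = (LINT x|lebesgue. deriv \<phi> x *\<^sub>R f x)"
    proof (rule integral_cong_AE)
      show "AE x in lebesgue. \<psi> x *\<^sub>R f0 x = deriv \<phi> x *\<^sub>R f x"
        using AE_completion[OF f0(1)] by eventually_elim (simp add: d)
    qed (unfold d, measurable)
    also have "\<dots> = - (LINT x|lebesgue. \<phi> x *\<^sub>R g x)" by (rule wd[OF \<phi>(1)])
    also have "(LINT x|lebesgue. \<phi> x *\<^sub>R g x) = (LINT x|lebesgue. \<phi> x *\<^sub>R G x)"
    proof (rule integral_cong_AE)
      show "AE x in lebesgue. \<phi> x *\<^sub>R g x = \<phi> x *\<^sub>R G x"
        using AE_completion[OF G(1)] by eventually_elim simp
    qed measurable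
    also have "\<dots> = (LINT x|lborel. \<phi> x *\<^sub>R G x)"
      by (rule integral_completion) measurable
    finally have 1: "(LINT x|lborel. \<psi> x *\<^sub>R f0 x) = - (LINT x|lborel. \<phi> x *\<^sub>R G x)" .
    have cs: "(LINT x|lborel. k x) = (LINT x:{a..b}|lborel. k x)" if "\<And>x. x \<notin> {a..b} \<Longrightarrow> k x = 0" for k :: "real \<Rightarrow> complex"
      unfolding set_lebesgue_integral_def
      by (intro Bochner_Integration.integral_cong refl) (use that in \<open>auto simp: indicator_def\<close>)
    have prim: "(LINT t:{a..s}|lborel. complex_of_real (\<psi> t)) = complex_of_real (\<phi> s)" if "s \<in> {a..b}" for s
    proof -
      have "\<phi> a = 0"
      proof (rule tendsto_unique[of "at_left a"])
        show "(\<phi> \<longlongrightarrow> \<phi> a) (at_left a)"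
          using \<phi>c by (auto simp: continuous_on_def intro: tendsto_within_subset)
        show "(\<phi> \<longlongrightarrow> 0) (at_left a)"
          by (rule tendsto_eventually) (auto simp: eventually_at_filter supp(1))
      qed simp
      have "(LBINT t=a..s. \<psi> t) = \<phi> s - \<phi> a"
      proof (rule interval_integral_FTC_finite)
        show "continuous_on {min a s..max a s} \<psi>" by (rule continuous_on_subset[OF \<phi>(3)]) simp
        show "(\<phi> has_vector_derivative \<psi> x) (at x within {min a s..max a s})" for x
          using \<phi>(2)[of x] has_real_derivative_iff_has_vector_derivative has_vector_derivative_at_within by blast
      qed
      then have "(LINT t:{a..s}|lborel. \<psi> t) = \<phi> s"
        using that \<open>\<phi> a = 0\<close> by (simp add: interval_integral_Icc)
      then show ?thesis by (simp add: set_integral_complex_of_real)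
    qed
    have "\<phi> b = 0"
    proof (rule tendsto_unique[of "at_right b"])
      show "(\<phi> \<longlongrightarrow> \<phi> b) (at_right b)"
        using \<phi>c by (auto simp: continuous_on_def intro: tendsto_within_subset)
      show "(\<phi> \<longlongrightarrow> 0) (at_right b)"
        by (rule tendsto_eventually) (auto simp: eventually_at_filter supp(1))
    qed simp
    have "(LINT x|lborel. \<psi> x *\<^sub>R H x) = (LINT x:{a..b}|lborel. \<psi> x *\<^sub>R H x)"
      by (rule cs) (simp add: supp)
    also have "\<dots> = (LINT x:{a..b}|lborel. H x * complex_of_real (\<psi> x))"
      by (simp add: scaleR_conv_of_real mult.commute)
    also have "\<dots> = H b * (LINT t:{a..b}|lborel. complex_of_real (\<psi> t))
         - (LINT s:{a..b}|lborel. G s * (LINT t:{a..s}|lborel. complex_of_real (\<psi> t)))"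
    proof (rule set_integral_by_parts_indefinite[OF G(2) _ \<phi>(4)])
      show "set_integrable lborel {a..b} (\<lambda>x. complex_of_real (\<psi> x))"
        by (intro borel_integrable_atLeastAtMost' continuous_intros continuous_on_subset[OF \<phi>(3)]) auto
    qed (use H in auto)
    also have "(LINT t:{a..b}|lborel. complex_of_real (\<psi> t)) = 0"
      using prim[of b] \<phi>(4) \<open>\<phi> b = 0\<close> by simp
    also have "(LINT s:{a..b}|lborel. G s * (LINT t:{a..s}|lborel. complex_of_real (\<psi> t))) = (LINT s:{a..b}|lborel. \<phi> s *\<^sub>R G s)"
      by (rule set_lebesgue_integral_cong) (auto simp: prim scaleR_conv_of_real mult.commute)
    also have "\<dots> = (LINT s|lborel. \<phi> s *\<^sub>R G s)"
      by (rule cs[symmetric]) (simp add: supp)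
    finally have 2: "(LINT x|lborel. \<psi> x *\<^sub>R H x) = - (LINT x|lborel. \<phi> x *\<^sub>R G x)" by simp
    have i: "integrable lborel (\<lambda>x. \<psi> x *\<^sub>R k x)" if "set_integrable lborel {a..b} k" for k :: "real \<Rightarrow> complex"
    proof -
      have "(\<lambda>x. indicator {a..b} x *\<^sub>R (\<psi> x *\<^sub>R k x)) = (\<lambda>x. \<psi> x *\<^sub>R k x)"
      proof
        fix x
        show "indicator {a..b} x *\<^sub>R (\<psi> x *\<^sub>R k x) = \<psi> x *\<^sub>R k x"
          by (cases "x \<in> {a..b}") (simp_all add: supp(2))
      qed
      with set_integrable_mult_continuous[OF that \<phi>(3)] show ?thesis
        unfolding set_integrable_def by (simp only:)
    qed
    have "(LINT x|lborel. \<psi> x *\<^sub>R (f0 x - H x)) = (LINT x|lborel. \<psi> x *\<^sub>R f0 x) - (LINT x|lborel. \<psi> x *\<^sub>R H x)"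
      unfolding scaleR_diff_right
      by (intro Bochner_Integration.integral_diff i f0 Hi)
    then show "(LINT x|lborel. \<psi> x *\<^sub>R (f0 x - H x)) = 0" using 1 2 by simp
  qed
  then obtain c where c: "AE x in lborel. f0 x - H x = c" by blast
  show ?thesis
  proof (rule that[of G "\<lambda>x. H x + c"])
    show "AE x in lborel. f x = H x + c"
      using f0(1) c by eventually_elim (simp add: algebra_simps)
  qed (use G H in auto)
qed

section \<open>Oscillatory integrals\<close>

text \<open>The first-derivative test of van der Corput, for a phase with \<open>\<theta>'\<close> of size at least
  \<open>t powr \<delta>\<close>. The function \<open>W = exp (i \<theta>) / (i \<theta>')\<close> has the derivative \<open>exp (i \<theta>)\<close> up to an error
  \<open>\<theta>'' / \<theta>'\<^sup>2\<close>, which is of size \<open>t powr (- \<delta> - 1)\<close> and so integrates to \<open>a powr (- \<delta>)\<close>, the size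
  of \<open>W\<close> at the end points.\<close>

lemma oscillatory_integral_bound:
  fixes \<theta> \<theta>' \<theta>'' :: "real \<Rightarrow> real"
  assumes ab: "0 < a" "a \<le> b" and k: "0 < \<kappa>" and \<delta>: "0 < \<delta>" and L: "0 \<le> L"
    and d1: "\<And>t. t \<in> {a..b} \<Longrightarrow> (\<theta> has_real_derivative \<theta>' t) (at t)"
    and d2: "\<And>t. t \<in> {a..b} \<Longrightarrow> (\<theta>' has_real_derivative \<theta>'' t) (at t)"
    and lower: "\<And>t. t \<in> {a..b} \<Longrightarrow> \<kappa> * t powr \<delta> \<le> \<bar>\<theta>' t\<bar>"
    and upper: "\<And>t. t \<in> {a..b} \<Longrightarrow> \<bar>\<theta>'' t\<bar> \<le> L * t powr (\<delta> - 1)"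
  shows "cmod (LINT t:{a..b}|lborel. exp (\<i> * complex_of_real (\<theta> t))) \<le> (2 / \<kappa> + L / (\<kappa>\<^sup>2 * \<delta>)) * a powr (- \<delta>)"
proof -
  define e where "e t = exp (\<i> * complex_of_real (\<theta> t))" for t
  define W where "W t = e t / (\<i> * complex_of_real (\<theta>' t))" for t
  define R where "R t = e t * (\<i> * complex_of_real (\<theta>'' t / (\<theta>' t)\<^sup>2))" for t
  have ne [simp]: "cmod (e t) = 1" for t by (simp add: e_def)
  have pos: "0 < \<bar>\<theta>' t\<bar>" if "t \<in> {a..b}" for t
    using lower[OF that] k that ab by (smt (verit) atLeastAtMost_iff mult_pos_pos powr_gt_zero)
  then have nz: "\<theta>' t \<noteq> 0" if "t \<in> {a..b}" for t using that by fastforce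
  have de: "(e has_vector_derivative e t * (\<i> * complex_of_real (\<theta>' t))) (at t within {a..b})" if "t \<in> {a..b}" for t
  proof -
    have "(\<theta> has_vector_derivative \<theta>' t) (at t within {a..b})"
      using d1[OF that] has_real_derivative_iff_has_vector_derivative has_vector_derivative_at_within by blast
    then have "((\<lambda>t. \<i> * complex_of_real (\<theta> t)) has_vector_derivative \<i> * complex_of_real (\<theta>' t)) (at t within {a..b})"
      by (intro has_vector_derivative_mult_right has_vector_derivative_of_real)
        (simp add: has_real_derivative_iff_has_vector_derivative)
    from field_vector_diff_chain_within[OF this DERIV_subset[OF DERIV_exp]]
    show ?thesis by (simp add: o_def e_def[abs_def] mult.commute)
  qed
  have dW: "(W has_vector_derivative e t + R t) (at t within {a..b})" if t: "t \<in> {a..b}" for t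
  proof -
    have "((\<lambda>t. - 1 / \<theta>' t) has_real_derivative \<theta>'' t / (\<theta>' t)\<^sup>2) (at t)"
      using nz[OF t] by (auto intro!: derivative_eq_intros d2[OF t] simp: power2_eq_square)
    then have "((\<lambda>t. - 1 / \<theta>' t) has_vector_derivative \<theta>'' t / (\<theta>' t)\<^sup>2) (at t within {a..b})"
      by (simp add: has_real_derivative_iff_has_vector_derivative has_vector_derivative_at_within)
    then have "((\<lambda>t. \<i> * complex_of_real (- 1 / \<theta>' t)) has_vector_derivative \<i> * complex_of_real (\<theta>'' t / (\<theta>' t)\<^sup>2)) (at t within {a..b})"
      by (intro has_vector_derivative_mult_right has_vector_derivative_of_real)
        (simp add: has_real_derivative_iff_has_vector_derivative)
    from has_vector_derivative_mult[OF de[OF t] this]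
    have "((\<lambda>t. e t * (\<i> * complex_of_real (- 1 / \<theta>' t))) has_vector_derivative
        e t * (\<i> * complex_of_real (\<theta>'' t / (\<theta>' t)\<^sup>2)) + e t * (\<i> * complex_of_real (\<theta>' t)) * (\<i> * complex_of_real (- 1 / \<theta>' t))) (at t within {a..b})" .
    moreover have "e t * (\<i> * complex_of_real (\<theta>' t)) * (\<i> * complex_of_real (- 1 / \<theta>' t)) = e t"
      using nz[OF t] by (simp add: field_simps)
    moreover have "(\<lambda>t. e t * (\<i> * complex_of_real (- 1 / \<theta>' t))) = W"
      by (auto simp: W_def fun_eq_iff divide_inverse)
    ultimately have "(W has_vector_derivative e t * (\<i> * complex_of_real (\<theta>'' t / (\<theta>' t)\<^sup>2)) + e t) (at t within {a..b})"
      by (simp only:)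
    then show ?thesis by (simp only: R_def add.commute)
  qed
  have iW: "((\<lambda>t. e t + R t) has_integral W b - W a) {a..b}"
    using ab dW by (intro fundamental_theorem_of_calculus) auto
  have ce: "continuous_on {a..b} e"
    unfolding continuous_on_eq_continuous_within by (blast intro: has_vector_derivative_continuous de)
  then have ie: "(e has_integral integral {a..b} e) {a..b}"
    by (intro integrable_integral integrable_continuous_real)
  have iR: "(R has_integral W b - W a - integral {a..b} e) {a..b}"
    using has_integral_diff[OF iW ie] by simp
  have ip: "((\<lambda>t. L / \<kappa>\<^sup>2 * t powr (- \<delta> - 1)) has_integral
      (- (L / (\<kappa>\<^sup>2 * \<delta>)) * b powr (- \<delta>)) - (- (L / (\<kappa>\<^sup>2 * \<delta>)) * a powr (- \<delta>))) {a..b}"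
  proof (intro fundamental_theorem_of_calculus ab)
    fix t assume t: "t \<in> {a..b}"
    have "((\<lambda>t. - (L / (\<kappa>\<^sup>2 * \<delta>)) * t powr (- \<delta>)) has_real_derivative - (L / (\<kappa>\<^sup>2 * \<delta>)) * (- \<delta> * t powr (- \<delta> - 1))) (at t)"
      using t ab by (intro DERIV_cmult has_real_derivative_powr) auto
    also have "- (L / (\<kappa>\<^sup>2 * \<delta>)) * (- \<delta> * t powr (- \<delta> - 1)) = L / \<kappa>\<^sup>2 * t powr (- \<delta> - 1)"
      using \<delta> k by (simp add: field_simps)
    finally show "((\<lambda>t. - (L / (\<kappa>\<^sup>2 * \<delta>)) * t powr (- \<delta>)) has_vector_derivative L / \<kappa>\<^sup>2 * t powr (- \<delta> - 1)) (at t within {a..b})"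
      by (simp add: has_real_derivative_iff_has_vector_derivative has_vector_derivative_at_within)
  qed
  have Rle: "cmod (R t) \<le> L / \<kappa>\<^sup>2 * t powr (- \<delta> - 1)" if t: "t \<in> {a..b}" for t
  proof -
    have t0: "0 < t" using t ab by auto
    have "cmod (R t) = \<bar>\<theta>'' t\<bar> / \<bar>\<theta>' t\<bar>\<^sup>2"
      by (simp add: R_def norm_mult norm_divide norm_power)
    also have "\<dots> \<le> (L * t powr (\<delta> - 1)) / (\<kappa> * t powr \<delta>)\<^sup>2"
      using k t0 L by (intro frac_le upper[OF t] power_mono lower[OF t]) auto
    also have "\<dots> = L / \<kappa>\<^sup>2 * (t powr (\<delta> - 1) / (t powr \<delta> * t powr \<delta>))"
      by (simp add: power_mult_distrib power2_eq_square)
    also have "t powr (\<delta> - 1) / (t powr \<delta> * t powr \<delta>) = t powr (- \<delta> - 1)"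
      using t0 by (simp add: powr_add[symmetric] powr_diff[symmetric])
    finally show ?thesis .
  qed
  have "cmod (W b - W a - integral {a..b} e) \<le> (- (L / (\<kappa>\<^sup>2 * \<delta>)) * b powr (- \<delta>)) - (- (L / (\<kappa>\<^sup>2 * \<delta>)) * a powr (- \<delta>))"
    using integral_norm_bound_integral[OF has_integral_integrable[OF iR] has_integral_integrable[OF ip] Rle]
    by (simp only: integral_unique[OF iR] integral_unique[OF ip])
  also have "\<dots> \<le> L / (\<kappa>\<^sup>2 * \<delta>) * a powr (- \<delta>)"
    using L \<delta> by simp
  finally have 1: "cmod (W b - W a - integral {a..b} e) \<le> L / (\<kappa>\<^sup>2 * \<delta>) * a powr (- \<delta>)" .
  have We: "cmod (W t) \<le> a powr (- \<delta>) / \<kappa>" if t: "t \<in> {a..b}" for t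
  proof -
    have "cmod (W t) = 1 / \<bar>\<theta>' t\<bar>" by (simp add: W_def norm_divide norm_mult)
    also have "\<dots> \<le> 1 / (\<kappa> * a powr \<delta>)"
    proof (rule divide_left_mono)
      have "\<kappa> * a powr \<delta> \<le> \<kappa> * t powr \<delta>"
        using t ab k \<delta> by (intro mult_left_mono powr_mono2) auto
      with lower[OF t] show "\<kappa> * a powr \<delta> \<le> \<bar>\<theta>' t\<bar>" by linarith
      show "0 < \<bar>\<theta>' t\<bar> * (\<kappa> * a powr \<delta>)" using pos[OF t] k ab by simp
    qed simp
    finally show ?thesis by (simp add: powr_minus divide_inverse mult.commute)
  qed
  have "(LINT t:{a..b}|lborel. e t) = integral {a..b} e"
    by (intro set_borel_integral_eq_integral(2) borel_integrable_atLeastAtMost' ce)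
  then have "cmod (LINT t:{a..b}|lborel. e t) = cmod (integral {a..b} e)" by (rule arg_cong)
  also have "\<dots> \<le> cmod (W b) + cmod (W a) + cmod (W b - W a - integral {a..b} e)"
    by norm
  also have "\<dots> \<le> a powr (- \<delta>) / \<kappa> + a powr (- \<delta>) / \<kappa> + L / (\<kappa>\<^sup>2 * \<delta>) * a powr (- \<delta>)"
    using ab by (intro add_mono We 1) auto
  also have "\<dots> = (2 / \<kappa> + L / (\<kappa>\<^sup>2 * \<delta>)) * a powr (- \<delta>)"
    by (simp add: algebra_simps)
  finally show ?thesis by (simp add: e_def[abs_def])
qed

text \<open>Far from the origin the term of highest order dominates the first derivative, uniformly in
  the coefficients: all quotients \<open>t powr (d j - d m)\<close> with \<open>j < m\<close> tend to \<open>0\<close>.\<close>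

lemma power_sum_derivative_bounds:
  fixes d :: "nat \<Rightarrow> real" and m :: nat
  assumes m: "1 \<le> m" and mono: "strict_mono_on {1..m} d" and d1: "2 \<le> d 1" and C: "0 \<le> C" and k: "0 < \<kappa>"
  shows "\<exists>R\<ge>1. \<forall>c t. (\<forall>j\<in>{1..m}. \<bar>c j\<bar> \<le> C) \<longrightarrow> \<kappa> \<le> \<bar>c m\<bar> \<longrightarrow> R \<le> t \<longrightarrow>
     \<kappa> / 2 * t powr (d m - 1) \<le> \<bar>\<Sum>j=1..m. c j * (d j * t powr (d j - 1))\<bar> \<and>
     \<bar>\<Sum>j=1..m. c j * (d j * ((d j - 1) * t powr (d j - 2)))\<bar> \<le> (\<Sum>j=1..m. C * (d j)\<^sup>2) * t powr (d m - 2)"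
proof -
  have dm: "d j < d m" if "j \<in> {1..<m}" for j
    using strict_mono_onD[OF mono, of j m] that m by auto
  have dge: "2 \<le> d j" if "j \<in> {1..m}" for j
  proof (cases "j = 1")
    case False
    then show ?thesis using strict_mono_onD[OF mono, of 1 j] that d1 by auto
  qed (use d1 in simp)
  have "((\<lambda>t. \<Sum>j=1..<m. C * (d j * t powr (d j - d m))) \<longlongrightarrow> (\<Sum>j=1..<m. C * (d j * 0))) at_top"
    by (intro tendsto_intros tendsto_neg_powr filterlim_ident) (use dm in auto)
  then have "\<forall>\<^sub>F t in at_top. (\<Sum>j=1..<m. C * (d j * t powr (d j - d m))) < \<kappa> / 2"
    by (rule order_tendstoD) (use k in simp)
  then obtain R where R: "\<And>t. R \<le> t \<Longrightarrow> (\<Sum>j=1..<m. C * (d j * t powr (d j - d m))) < \<kappa> / 2"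
    by (auto simp: eventually_at_top_linorder)
  show ?thesis
  proof (intro exI[of _ "max 1 R"] conjI allI impI)
    fix c :: "nat \<Rightarrow> real" and t
    assume c: "\<forall>j\<in>{1..m}. \<bar>c j\<bar> \<le> C" and cm: "\<kappa> \<le> \<bar>c m\<bar>" and t: "max 1 R \<le> t"
    have split: "{1..m} = insert m {1..<m}" using m by auto
    have "\<bar>\<Sum>j=1..<m. c j * (d j * t powr (d j - 1))\<bar> \<le> (\<Sum>j=1..<m. \<bar>c j * (d j * t powr (d j - 1))\<bar>)"
      by (rule sum_abs)
    also have "\<dots> \<le> (\<Sum>j=1..<m. C * (d j * t powr (d j - d m)) * t powr (d m - 1))"
    proof (rule sum_mono)
      fix j assume j: "j \<in> {1..<m}"
      have d0: "0 \<le> d j" using dge[of j] j by auto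
      have "\<bar>c j * (d j * t powr (d j - 1))\<bar> = \<bar>c j\<bar> * (d j * t powr (d j - 1))"
        using d0 by (simp add: abs_mult)
      also have "\<dots> \<le> C * (d j * t powr (d j - 1))"
        using c j d0 by (intro mult_right_mono) auto
      also have "\<dots> = C * (d j * (t powr (d j - d m) * t powr (d m - 1)))"
        by (subst powr_add[symmetric]) simp
      finally show "\<bar>c j * (d j * t powr (d j - 1))\<bar> \<le> C * (d j * t powr (d j - d m)) * t powr (d m - 1)"
        by (simp add: mult.assoc)
    qed
    also have "\<dots> \<le> \<kappa> / 2 * t powr (d m - 1)"
      unfolding sum_distrib_right[symmetric] using R[of t] t by (intro mult_right_mono) auto
    finally have rest: "\<bar>\<Sum>j=1..<m. c j * (d j * t powr (d j - 1))\<bar> \<le> \<kappa> / 2 * t powr (d m - 1)" .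
    have "\<kappa> * 1 \<le> \<bar>c m\<bar> * d m" using cm k dge[of m] m by (intro mult_mono) auto
    then have "\<kappa> * t powr (d m - 1) \<le> \<bar>c m\<bar> * d m * t powr (d m - 1)" by (intro mult_right_mono) auto
    also have "\<dots> = \<bar>c m * (d m * t powr (d m - 1))\<bar>" using dge[of m] m by (simp add: abs_mult)
    finally have lead: "\<kappa> * t powr (d m - 1) \<le> \<bar>c m * (d m * t powr (d m - 1))\<bar>" .
    have "(\<Sum>j=1..m. c j * (d j * t powr (d j - 1))) = c m * (d m * t powr (d m - 1)) + (\<Sum>j=1..<m. c j * (d j * t powr (d j - 1)))"
      unfolding split by (subst sum.insert) auto
    with rest lead show "\<kappa> / 2 * t powr (d m - 1) \<le> \<bar>\<Sum>j=1..m. c j * (d j * t powr (d j - 1))\<bar>"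
      by linarith
    have "\<bar>\<Sum>j=1..m. c j * (d j * ((d j - 1) * t powr (d j - 2)))\<bar> \<le> (\<Sum>j=1..m. \<bar>c j * (d j * ((d j - 1) * t powr (d j - 2)))\<bar>)"
      by (rule sum_abs)
    also have "\<dots> \<le> (\<Sum>j=1..m. C * (d j)\<^sup>2 * t powr (d m - 2))"
    proof (rule sum_mono)
      fix j assume j: "j \<in> {1..m}"
      have d2: "2 \<le> d j" by (rule dge[OF j])
      have "\<bar>c j * (d j * ((d j - 1) * t powr (d j - 2)))\<bar> = \<bar>c j\<bar> * (d j * ((d j - 1) * t powr (d j - 2)))"
        using d2 by (simp add: abs_mult)
      also have "\<dots> \<le> C * (d j * (d j * t powr (d m - 2)))"
      proof (intro mult_mono)
        show "\<bar>c j\<bar> \<le> C" using c j by blast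
        show "t powr (d j - 2) \<le> t powr (d m - 2)"
          using dm[of j] j t by (cases "j = m") (auto intro!: powr_mono)
      qed (use d2 C in auto)
      finally show "\<bar>c j * (d j * ((d j - 1) * t powr (d j - 2)))\<bar> \<le> C * (d j)\<^sup>2 * t powr (d m - 2)"
        by (simp add: power2_eq_square mult.assoc)
    qed
    finally show "\<bar>\<Sum>j=1..m. c j * (d j * ((d j - 1) * t powr (d j - 2)))\<bar> \<le> (\<Sum>j=1..m. C * (d j)\<^sup>2) * t powr (d m - 2)"
      by (simp add: sum_distrib_right)
  qed simp
qed

lemma set_lebesgue_integral_reflect:
  fixes k :: "real \<Rightarrow> 'b::{banach, second_countable_topology}"
  shows "(LINT t:{x - b..x - a}|lborel. k t) = (LINT s:{a..b}|lborel. k (x - s))"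
proof -
  have "(LINT t|lborel. indicator {x - b..x - a} t *\<^sub>R k t)
      = \<bar>- 1\<bar> *\<^sub>R (LINT s|lborel. indicator {x - b..x - a} (x + - 1 * s) *\<^sub>R k (x + - 1 * s))"
    by (rule lborel_integral_real_affine) simp
  also have "(\<lambda>s. indicator {x - b..x - a} (x + - 1 * s) *\<^sub>R k (x + - 1 * s)) = (\<lambda>s. indicator {a..b} s *\<^sub>R k (x - s))"
    by (auto simp: fun_eq_iff indicator_def)
  finally show ?thesis by (simp add: set_lebesgue_integral_def)
qed

text \<open>An interval that stays away from the origin lies on one side of it, and the phase is even,
  so the negative side reduces to the positive one.\<close>

lemma power_sum_phase_oscillation:
  fixes d :: "nat \<Rightarrow> real" and m :: nat
  assumes m: "1 \<le> m" and mono: "strict_mono_on {1..m} d" and d1: "2 \<le> d 1" and C: "0 \<le> C" and k: "0 < \<kappa>"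
  shows "\<exists>R\<ge>1. \<exists>B\<ge>0. \<forall>c a b \<rho>. (\<forall>j\<in>{1..m}. \<bar>c j\<bar> \<le> C) \<longrightarrow> \<kappa> \<le> \<bar>c m\<bar> \<longrightarrow> R \<le> \<rho> \<longrightarrow> (\<forall>t\<in>{a..b}. \<rho> \<le> \<bar>t\<bar>) \<longrightarrow>
     cmod (LINT t:{a..b}|lborel. exp (\<i> * complex_of_real (\<Sum>j=1..m. c j * \<bar>t\<bar> powr d j))) \<le> B * \<rho> powr (- (d m - 1))"
proof -
  obtain R where R: "1 \<le> R" and bounds: "\<And>c t. (\<forall>j\<in>{1..m}. \<bar>c j\<bar> \<le> C) \<Longrightarrow> \<kappa> \<le> \<bar>c m\<bar> \<Longrightarrow> R \<le> t \<Longrightarrow>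
     \<kappa> / 2 * t powr (d m - 1) \<le> \<bar>\<Sum>j=1..m. c j * (d j * t powr (d j - 1))\<bar> \<and>
     \<bar>\<Sum>j=1..m. c j * (d j * ((d j - 1) * t powr (d j - 2)))\<bar> \<le> (\<Sum>j=1..m. C * (d j)\<^sup>2) * t powr (d m - 2)"
    using power_sum_derivative_bounds[OF assms] by blast
  have dm: "2 \<le> d m"
    using strict_mono_onD[OF mono, of 1 m] m d1 by (cases "m = 1") auto
  define L where "L = (\<Sum>j=1..m. C * (d j)\<^sup>2)"
  have L: "0 \<le> L" using C by (simp add: L_def sum_nonneg)
  define B where "B = 2 / (\<kappa> / 2) + L / ((\<kappa> / 2)\<^sup>2 * (d m - 1))"
  have B: "0 \<le> B" using L k dm by (simp add: B_def)
  have main: "cmod (LINT t:{a..b}|lborel. exp (\<i> * complex_of_real (\<Sum>j=1..m. c j * \<bar>t\<bar> powr d j))) \<le> B * \<rho> powr (- (d m - 1))"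
    if c: "\<forall>j\<in>{1..m}. \<bar>c j\<bar> \<le> C" "\<kappa> \<le> \<bar>c m\<bar>" and \<rho>: "R \<le> \<rho>" "\<rho> \<le> a" "a \<le> b" for c a b \<rho>
  proof -
    have a0: "0 < a" using R \<rho> by linarith
    have "(LINT t:{a..b}|lborel. exp (\<i> * complex_of_real (\<Sum>j=1..m. c j * \<bar>t\<bar> powr d j)))
      = (LINT t:{a..b}|lborel. exp (\<i> * complex_of_real (\<Sum>j=1..m. c j * t powr d j)))"
      by (rule set_lebesgue_integral_cong) (use a0 in auto)
    also have "cmod \<dots> \<le> B * a powr (- (d m - 1))"
      unfolding B_def
    proof (rule oscillatory_integral_bound[OF a0 \<rho>(3) _ _ L])
      fix t assume t: "t \<in> {a..b}"
      then have t0: "0 < t" "R \<le> t" using a0 \<rho> by auto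
      show "((\<lambda>t. \<Sum>j=1..m. c j * t powr d j) has_real_derivative (\<Sum>j=1..m. c j * (d j * t powr (d j - 1)))) (at t)"
        using t0 by (intro DERIV_sum DERIV_cmult has_real_derivative_powr)
      have "((\<lambda>t. \<Sum>j=1..m. c j * (d j * t powr (d j - 1))) has_real_derivative (\<Sum>j=1..m. c j * (d j * ((d j - 1) * t powr (d j - 1 - 1))))) (at t)"
        using t0 by (intro DERIV_sum DERIV_cmult has_real_derivative_powr)
      then show "((\<lambda>t. \<Sum>j=1..m. c j * (d j * t powr (d j - 1))) has_real_derivative (\<Sum>j=1..m. c j * (d j * ((d j - 1) * t powr (d j - 2))))) (at t)"
        by simp
      show "\<kappa> / 2 * t powr (d m - 1) \<le> \<bar>\<Sum>j=1..m. c j * (d j * t powr (d j - 1))\<bar>"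
        using bounds[OF c t0(2)] by blast
      show "\<bar>\<Sum>j=1..m. c j * (d j * ((d j - 1) * t powr (d j - 2)))\<bar> \<le> L * t powr (d m - 1 - 1)"
        using bounds[OF c t0(2)] by (simp add: L_def)
    qed (use k dm in auto)
    also have "\<dots> \<le> B * \<rho> powr (- (d m - 1))"
      using B R \<rho> dm by (intro mult_left_mono powr_mono2') auto
    finally show ?thesis .
  qed
  show ?thesis
  proof (rule exI[of _ R], rule conjI[OF R], rule exI[of _ B], rule conjI[OF B], intro allI impI)
    fix c :: "nat \<Rightarrow> real" and a b \<rho>
    assume c: "\<forall>j\<in>{1..m}. \<bar>c j\<bar> \<le> C" "\<kappa> \<le> \<bar>c m\<bar>" and \<rho>: "R \<le> \<rho>" and away: "\<forall>t\<in>{a..b}. \<rho> \<le> \<bar>t\<bar>"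
    let ?I = "LINT t:{a..b}|lborel. exp (\<i> * complex_of_real (\<Sum>j=1..m. c j * \<bar>t\<bar> powr d j))"
    consider "b < a" | "a \<le> b" "\<rho> \<le> a" | "a \<le> b" "b \<le> - \<rho>"
    proof (cases "a \<le> b")
      case True
      have "\<rho> \<le> \<bar>a\<bar>" "\<rho> \<le> \<bar>b\<bar>" using away True by auto
      moreover have "\<not> (a \<le> 0 \<and> 0 \<le> b)" using away R \<rho> by force
      ultimately show ?thesis using that True by linarith
    qed (use that in auto)
    then show "cmod ?I \<le> B * \<rho> powr (- (d m - 1))"
    proof cases
      case 1
      then show ?thesis using B by (simp add: set_lebesgue_integral_def)
    next
      case 2
      then show ?thesis using main[OF c \<rho>] by blast
    next
      case 3
      have "?I = (LINT t:{- b..- a}|lborel. exp (\<i> * complex_of_real (\<Sum>j=1..m. c j * \<bar>t\<bar> powr d j)))"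
        using set_lebesgue_integral_reflect[of 0 "- a" "- b" "\<lambda>t. exp (\<i> * complex_of_real (\<Sum>j=1..m. c j * \<bar>t\<bar> powr d j))"]
        by simp
      then show ?thesis using main[OF c \<rho>, of "- b" "- a"] 3 by simp
    qed
  qed
qed

text \<open>The oscillation is carried entirely by the primitive of \<open>e\<close>, which is at most \<open>M\<close>;
  integration by parts against it costs one boundary value and the variation of \<open>F\<close>.\<close>

lemma indefinite_integral_oscillation:
  fixes F G e :: "real \<Rightarrow> complex"
  assumes G: "\<And>a b. set_integrable lborel {a..b} G"
    and F: "\<And>x y. x \<le> y \<Longrightarrow> F y - F x = (LINT s:{x..y}|lborel. G s)"
    and e: "set_integrable lborel {\<alpha>..\<beta>} e" and le: "\<alpha> \<le> \<beta>"
    and M: "\<And>s. s \<in> {\<alpha>..\<beta>} \<Longrightarrow> cmod (LINT t:{\<alpha>..s}|lborel. e t) \<le> M"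
  shows "cmod (LINT t:{\<alpha>..\<beta>}|lborel. F (x - t) * e t)
    \<le> (cmod (F (x - \<beta>)) + (LINT y:{x - \<beta>..x - \<alpha>}|lborel. cmod (G y))) * M"
proof -
  have M0: "0 \<le> M" using M[of \<beta>] le norm_ge_zero order_trans by (metis atLeastAtMost_iff order_refl)
  have Gx: "set_integrable lborel {\<alpha>..\<beta>} (\<lambda>s. - G (x - s))"
  proof -
    have "integrable lborel (\<lambda>s. indicator {x - \<beta>..x - \<alpha>} (x + - 1 * s) *\<^sub>R G (x + - 1 * s))"
      using G[of "x - \<beta>" "x - \<alpha>"] unfolding set_integrable_def by (rule lborel_integrable_real_affine) simp
    also have "(\<lambda>s. indicator {x - \<beta>..x - \<alpha>} (x + - 1 * s) *\<^sub>R G (x + - 1 * s)) = (\<lambda>s. indicator {\<alpha>..\<beta>} s *\<^sub>R G (x - s))"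
      by (auto simp: fun_eq_iff indicator_def)
    finally show ?thesis by (simp add: set_integrable_def)
  qed
  have reflF: "F (x - \<beta>) - F (x - t) = (LINT s:{t..\<beta>}|lborel. - G (x - s))" if "t \<in> {\<alpha>..\<beta>}" for t
    using F[of "x - \<beta>" "x - t"] set_lebesgue_integral_reflect[of x \<beta> t "\<lambda>y. - G y"] that G[of "x - \<beta>" "x - t"]
    by (simp add: set_integral_uminus) (metis minus_diff_eq)
  define E where "E s = (LINT t:{\<alpha>..s}|lborel. e t)" for s
  have "(LINT t:{\<alpha>..\<beta>}|lborel. F (x - t) * e t) = F (x - \<beta>) * E \<beta> - (LINT s:{\<alpha>..\<beta>}|lborel. - G (x - s) * E s)"
    unfolding E_def by (rule set_integral_by_parts_indefinite[where u = "\<lambda>t. F (x - t)", OF Gx e le reflF])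
  also have "cmod \<dots> \<le> cmod (F (x - \<beta>)) * cmod (E \<beta>) + cmod (LINT s:{\<alpha>..\<beta>}|lborel. - G (x - s) * E s)"
    unfolding norm_mult[symmetric] by (rule norm_triangle_ineq4)
  also have "cmod (LINT s:{\<alpha>..\<beta>}|lborel. - G (x - s) * E s) \<le> (LINT s:{\<alpha>..\<beta>}|lborel. cmod (G (x - s)) * M)"
    unfolding set_lebesgue_integral_def
  proof (rule Bochner_Integration.integral_norm_bound_integral)
    have nG: "set_integrable lborel {\<alpha>..\<beta>} (\<lambda>s. cmod (G (x - s)))"
      using set_integrable_norm[OF Gx] by simp
    from set_integrable_mult_left[where a = M, OF this]
    show iM: "integrable lborel (\<lambda>s. indicator {\<alpha>..\<beta>} s *\<^sub>R (cmod (G (x - s)) * M))"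
      unfolding set_integrable_def by blast
    have "continuous_on {\<alpha>..\<beta>} (\<lambda>s. integral {\<alpha>..s} e)"
      by (intro indefinite_integral_continuous_1 set_borel_integral_eq_integral(1)[OF e])
    also have "?this \<longleftrightarrow> continuous_on {\<alpha>..\<beta>} E"
    proof (rule continuous_on_cong[OF refl])
      fix s assume "s \<in> {\<alpha>..\<beta>}"
      then have "set_integrable lborel {\<alpha>..s} e" by (intro set_integrable_subset[OF e]) auto
      then show "integral {\<alpha>..s} e = E s" by (simp add: E_def set_borel_integral_eq_integral(2))
    qed
    finally have Ec: "continuous_on {\<alpha>..\<beta>} E" .
    have Em: "(\<lambda>s. indicator {\<alpha>..\<beta>} s *\<^sub>R E s) \<in> borel_measurable lborel"
      using borel_integrable_atLeastAtMost'[OF Ec] unfolding set_integrable_def by (rule borel_measurable_integrable)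
    show "integrable lborel (\<lambda>s. indicator {\<alpha>..\<beta>} s *\<^sub>R (- G (x - s) * E s))"
    proof (rule Bochner_Integration.integrable_bound)
      show "integrable lborel (\<lambda>s. indicator {\<alpha>..\<beta>} s *\<^sub>R (cmod (G (x - s)) * M))" by (rule iM)
      have "(\<lambda>s. (indicator {\<alpha>..\<beta>} s *\<^sub>R - G (x - s)) * (indicator {\<alpha>..\<beta>} s *\<^sub>R E s)) \<in> borel_measurable lborel"
        using Gx unfolding set_integrable_def by (intro borel_measurable_times Em borel_measurable_integrable)
      also have "(\<lambda>s. (indicator {\<alpha>..\<beta>} s *\<^sub>R - G (x - s)) * (indicator {\<alpha>..\<beta>} s *\<^sub>R E s)) = (\<lambda>s. indicator {\<alpha>..\<beta>} s *\<^sub>R (- G (x - s) * E s))"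
        by (auto simp: fun_eq_iff indicator_def)
      finally show "(\<lambda>s. indicator {\<alpha>..\<beta>} s *\<^sub>R (- G (x - s) * E s)) \<in> borel_measurable lborel" .
      show "AE s in lborel. norm (indicator {\<alpha>..\<beta>} s *\<^sub>R (- G (x - s) * E s)) \<le> norm (indicator {\<alpha>..\<beta>} s *\<^sub>R (cmod (G (x - s)) * M))"
        using M M0 by (intro AE_I2) (auto simp: indicator_def norm_mult E_def intro!: mult_left_mono)
    qed
    show "norm (indicator {\<alpha>..\<beta>} s *\<^sub>R (- G (x - s) * E s)) \<le> indicator {\<alpha>..\<beta>} s *\<^sub>R (cmod (G (x - s)) * M)" for s
      using M M0 by (auto simp: indicator_def norm_mult E_def intro!: mult_left_mono)
  qed
  also have "(LINT s:{\<alpha>..\<beta>}|lborel. cmod (G (x - s)) * M) = (LINT s:{\<alpha>..\<beta>}|lborel. cmod (G (x - s))) * M"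
    by (rule set_integral_mult_left)
  also have "(LINT s:{\<alpha>..\<beta>}|lborel. cmod (G (x - s))) = (LINT y:{x - \<beta>..x - \<alpha>}|lborel. cmod (G y))"
    by (rule set_lebesgue_integral_reflect[symmetric])
  also have "cmod (F (x - \<beta>)) * cmod (E \<beta>) \<le> cmod (F (x - \<beta>)) * M"
    using M[of \<beta>] le by (intro mult_left_mono) (auto simp: E_def)
  finally show ?thesis by (simp add: algebra_simps)
qed

section \<open>The pointwise bound\<close>

lemma indefinite_integral_variation:
  fixes F G :: "real \<Rightarrow> complex"
  assumes G: "\<And>a b. set_integrable lborel {a..b} G"
    and F: "\<And>x y. x \<le> y \<Longrightarrow> F y - F x = (LINT s:{x..y}|lborel. G s)"
    and yz: "y \<in> {a..b}" "z \<in> {a..b}"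
  shows "cmod (F y - F z) \<le> (LINT s:{a..b}|lborel. cmod (G s))"
proof -
  have main: "cmod (F y - F z) \<le> (LINT s:{a..b}|lborel. cmod (G s))"
    if "z \<le> y" "y \<in> {a..b}" "z \<in> {a..b}" for y z
  proof -
    have i: "integrable lborel (\<lambda>s. indicator {a..b} s *\<^sub>R cmod (G s))"
      using set_integrable_norm[OF G] by (simp add: set_integrable_def)
    have "cmod (F y - F z) = cmod (LINT s|lborel. indicator {z..y} s *\<^sub>R G s)"
      using F[OF that(1)] by (simp add: set_lebesgue_integral_def)
    also have "\<dots> \<le> (LINT s|lborel. cmod (indicator {z..y} s *\<^sub>R G s))"
      by (rule integral_norm_bound)
    also have "\<dots> \<le> (LINT s|lborel. indicator {a..b} s *\<^sub>R cmod (G s))"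
      by (rule integral_mono'[OF i]) (use that in \<open>auto simp: indicator_def\<close>)
    finally show ?thesis by (simp add: set_lebesgue_integral_def)
  qed
  show ?thesis
  proof (cases "z \<le> y")
    case False
    then show ?thesis using main[of y z] yz by (simp add: norm_minus_commute)
  qed (use main yz in blast)
qed

lemma average_le_value_plus_variation:
  fixes F G e :: "real \<Rightarrow> complex"
  assumes G: "\<And>a b. set_integrable lborel {a..b} G"
    and F: "\<And>x y. x \<le> y \<Longrightarrow> F y - F x = (LINT s:{x..y}|lborel. G s)"
    and e: "\<And>t. cmod (e t) \<le> 1" and r: "0 < r"
  shows "1 / (2 * r) * cmod (LINT t:{-r..r}|lborel. F (x - t) * e t)
    \<le> cmod (F x) + (LINT s:{x - r..x + r}|lborel. cmod (G s))"
proof -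
  define v where "v = cmod (F x) + (LINT s:{x - r..x + r}|lborel. cmod (G s))"
  have v: "cmod (F (x - t)) \<le> v" if "t \<in> {-r..r}" for t
    using indefinite_integral_variation[OF G F, of "x - t" "x - r" "x + r" x] that r
      norm_triangle_sub[of "F (x - t)" "F x"] by (auto simp: v_def)
  have "cmod (LINT t:{-r..r}|lborel. F (x - t) * e t) \<le> (LINT t|lborel. cmod (indicator {-r..r} t *\<^sub>R (F (x - t) * e t)))"
    unfolding set_lebesgue_integral_def by (rule integral_norm_bound)
  also have "\<dots> \<le> (LINT t|lborel. indicator {-r..r} t *\<^sub>R v)"
  proof (rule integral_mono')
    have "set_integrable lborel {-r..r} (\<lambda>_. v)" by (intro borel_integrable_atLeastAtMost') simp
    then show "integrable lborel (\<lambda>t. indicator {-r..r} t *\<^sub>R v)" by (simp only: set_integrable_def)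
    have "0 \<le> v" using v[of 0] r order_trans[OF norm_ge_zero] by force
    then show "0 \<le> indicator {-r..r} t *\<^sub>R v" for t by simp
    show "cmod (indicator {-r..r} t *\<^sub>R (F (x - t) * e t)) \<le> indicator {-r..r} t *\<^sub>R v" for t
    proof (cases "t \<in> {-r..r}")
      case True
      have "cmod (F (x - t) * e t) \<le> cmod (F (x - t))"
        using mult_left_mono[OF e, of "cmod (F (x - t))" t] by (simp add: norm_mult)
      with v[OF True] True show ?thesis by simp
    qed simp
  qed
  also have "\<dots> = 2 * r * v" using r by simp
  finally show ?thesis using r by (simp add: v_def field_simps)
qed

definition weight :: "real \<Rightarrow> real \<Rightarrow> real" where
  "weight l x = 1 + \<bar>x\<bar> powr l"

lemma weight_ge_1: "1 \<le> weight l x" and weight_pos: "0 < weight l x"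
proof -
  show "1 \<le> weight l x" by (simp add: weight_def)
  then show "0 < weight l x" by linarith
qed

lemma weight_measurable [measurable]: "weight l \<in> borel_measurable borel"
  unfolding weight_def[abs_def] by measurable

text \<open>The three terms dominate the factor \<open>1 / (2 * r)\<close> of an average of radius
  \<open>r > 1 / weight l x\<close> at the point \<open>y = x - t\<close>, respectively for \<open>\<bar>t\<bar> \<le> 1\<close>, for \<open>1 < \<bar>t\<bar> \<le> 3 * \<bar>y\<bar>\<close>, and
  for all \<open>\<bar>t\<bar> > 1\<close> when \<open>x\<close> is near the origin. In the last two cases \<open>r \<ge> 1\<close>, so the bound \<open>1\<close>
  suffices.\<close>

definition schur_kernel :: "real \<Rightarrow> real \<Rightarrow> real \<Rightarrow> real \<Rightarrow> real" where
  "schur_kernel l R x y = (if \<bar>x - y\<bar> \<le> 1 then weight l x else 0) + (if \<bar>x - y\<bar> \<le> 3 * \<bar>y\<bar> then 1 else 0)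
     + (if \<bar>x\<bar> \<le> 2 * R then 1 else 0)"

lemma schur_kernel_nonneg: "0 \<le> schur_kernel l R x y"
  using weight_ge_1[of l x] by (auto simp: schur_kernel_def)

lemma schur_kernel_measurable [measurable]: "(\<lambda>(x, y). schur_kernel l R x y) \<in> borel_measurable (borel \<Otimes>\<^sub>M borel)"
  unfolding schur_kernel_def by measurable

lemma nn_integral_reflect:
  fixes f :: "real \<Rightarrow> ennreal"
  assumes [measurable]: "f \<in> borel_measurable borel"
  shows "(\<integral>\<^sup>+t. f (x - t) \<partial>lborel) = (\<integral>\<^sup>+y. f y \<partial>lborel)"
  using nn_integral_real_affine[of f "-1" x] by simp

lemma average_le_schur_kernel:
  fixes F e :: "real \<Rightarrow> complex"
  assumes [measurable]: "F \<in> borel_measurable borel" "S \<in> sets borel"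
    and e: "\<And>t. cmod (e t) \<le> 1" and r: "1 / weight l x < r" and S: "S \<subseteq> {-r..r}"
    and i: "set_integrable lborel S (\<lambda>t. F (x - t) * e t)"
    and near: "\<And>t. t \<in> S \<Longrightarrow> \<bar>t\<bar> \<le> 1 \<or> \<bar>t\<bar> \<le> 3 * \<bar>x - t\<bar> \<or> \<bar>x\<bar> \<le> 2 * R"
  shows "ennreal (1 / (2 * r) * cmod (LINT t:S|lborel. F (x - t) * e t))
    \<le> (\<integral>\<^sup>+y. ennreal (schur_kernel l R x y * cmod (F y)) \<partial>lborel)"
proof -
  have r0: "0 < r" using r weight_pos[of l x] by (smt (verit) divide_nonneg_pos)
  have le: "1 / (2 * r) \<le> schur_kernel l R x (x - t)" if t: "t \<in> S" for t
  proof (cases "\<bar>t\<bar> \<le> 1")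
    case True
    have "1 / (2 * r) \<le> 1 / r" using r0 by (simp add: field_simps)
    also have "\<dots> \<le> weight l x" using r r0 weight_pos[of l x] by (simp add: field_simps)
    also have "\<dots> \<le> schur_kernel l R x (x - t)" using True by (simp add: schur_kernel_def)
    finally show ?thesis .
  next
    case False
    then have "1 \<le> r" using S t by fastforce
    then have "1 / (2 * r) \<le> 1" by simp
    also have "\<dots> \<le> schur_kernel l R x (x - t)"
      using near[OF t] False weight_ge_1[of l x] by (auto simp: schur_kernel_def)
    finally show ?thesis .
  qed
  have "ennreal (1 / (2 * r) * cmod (LINT t:S|lborel. F (x - t) * e t))
      = ennreal (1 / (2 * r)) * ennreal (cmod (LINT t|lborel. indicator S t *\<^sub>R (F (x - t) * e t)))"
    using r0 by (simp add: ennreal_mult'[symmetric] set_lebesgue_integral_def)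
  also have "\<dots> \<le> ennreal (1 / (2 * r)) * (\<integral>\<^sup>+t. ennreal (cmod (indicator S t *\<^sub>R (F (x - t) * e t))) \<partial>lborel)"
    by (intro mult_left_mono integral_norm_bound_ennreal[OF i[unfolded set_integrable_def]]) simp
  also have "\<dots> = (\<integral>\<^sup>+t. ennreal (1 / (2 * r)) * ennreal (cmod (indicator S t *\<^sub>R (F (x - t) * e t))) \<partial>lborel)"
    by (intro nn_integral_cmult[symmetric] measurable_compose[OF _ measurable_ennreal]
        measurable_compose[OF borel_measurable_integrable[OF i[unfolded set_integrable_def]] borel_measurable_norm])
  also have "\<dots> \<le> (\<integral>\<^sup>+t. ennreal (schur_kernel l R x (x - t) * cmod (F (x - t))) \<partial>lborel)"
  proof (rule nn_integral_mono)
    fix t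
    show "ennreal (1 / (2 * r)) * ennreal (cmod (indicator S t *\<^sub>R (F (x - t) * e t))) \<le> ennreal (schur_kernel l R x (x - t) * cmod (F (x - t)))"
    proof (cases "t \<in> S")
      case True
      have "1 / (2 * r) * cmod (F (x - t) * e t) \<le> schur_kernel l R x (x - t) * cmod (F (x - t))"
      proof (rule mult_mono[OF le[OF True]])
        show "cmod (F (x - t) * e t) \<le> cmod (F (x - t))"
          using mult_left_mono[OF e, of "cmod (F (x - t))" t] by (simp add: norm_mult)
      qed (auto intro: schur_kernel_nonneg)
      then show ?thesis using True r0 by (simp add: ennreal_mult'[symmetric] ennreal_leI)
    qed simp
  qed
  also have "\<dots> = (\<integral>\<^sup>+y. ennreal (schur_kernel l R x y * cmod (F y)) \<partial>lborel)"
    by (rule nn_integral_reflect) measurable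
  finally show ?thesis .
qed

text \<open>Compare \<open>F y\<close> with \<open>F z\<close> and average over \<open>z\<close>.\<close>

lemma indefinite_integral_sup_bound:
  fixes F G :: "real \<Rightarrow> complex"
  assumes G: "\<And>a b. set_integrable lborel {a..b} G"
    and F: "\<And>x y. x \<le> y \<Longrightarrow> F y - F x = (LINT s:{x..y}|lborel. G s)"
    and iF: "integrable lborel F" and P: "0 < P" and y: "y \<in> {-P..P}"
  shows "cmod (F y) \<le> (LINT z|lborel. cmod (F z)) / (2 * P) + (LINT s:{-P..P}|lborel. cmod (G s))"
proof -
  define V where "V = (LINT s:{-P..P}|lborel. cmod (G s))"
  have le: "cmod (F y) \<le> cmod (F z) + V" if "z \<in> {-P..P}" for z
    using indefinite_integral_variation[OF G F y that] norm_triangle_sub[of "F y" "F z"] by (simp add: V_def)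
  have c: "integrable lborel (\<lambda>z. indicator {-P..P} z *\<^sub>R c)" for c :: real
    using borel_integrable_atLeastAtMost'[of "-P" P "\<lambda>_. c"] by (simp add: set_integrable_def)
  have "2 * P * cmod (F y) = (LINT z|lborel. indicator {-P..P} z *\<^sub>R cmod (F y))"
    using P by simp
  also have "\<dots> \<le> (LINT z|lborel. cmod (F z) + indicator {-P..P} z *\<^sub>R V)"
  proof (rule integral_mono[OF c])
    show "integrable lborel (\<lambda>z. cmod (F z) + indicator {-P..P} z *\<^sub>R V)"
      using iF c by (intro Bochner_Integration.integrable_add) auto
    show "indicator {-P..P} z *\<^sub>R cmod (F y) \<le> cmod (F z) + indicator {-P..P} z *\<^sub>R V" for z
      using le[of z] by (cases "z \<in> {-P..P}") auto
  qed
  also have "\<dots> = (LINT z|lborel. cmod (F z)) + 2 * P * V"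
    using iF P by (subst Bochner_Integration.integral_add[OF _ c]) auto
  finally show ?thesis using P by (simp add: V_def field_simps)
qed

text \<open>This is the only place where the oscillation enters. On the piece \<open>\<bar>t - x\<bar> \<le> \<bar>x\<bar> / 2\<close> the argument
  of \<open>F\<close> stays in \<open>[-P, P]\<close> with \<open>P = \<bar>x\<bar> / 2\<close>, and \<open>\<bar>t\<bar> \<ge> P\<close>, so the phase gains \<open>P powr (- \<delta>)\<close> while
  \<open>F\<close> and its variation grow at most like \<open>P powr \<sigma>\<close>. Unless the piece is empty the radius is at least \<open>P\<close>, which supplies the
  remaining factor \<open>1 / P\<close>; without the phase this factor alone would not be integrable in \<open>x\<close>.\<close>

lemma far_oscillation_bound:
  fixes F G e :: "real \<Rightarrow> complex"
  assumes G: "\<And>a b. set_integrable lborel {a..b} G"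
    and F: "\<And>x y. x \<le> y \<Longrightarrow> F y - F x = (LINT s:{x..y}|lborel. G s)"
    and iF: "integrable lborel F"
    and N: "0 \<le> N" and B: "0 \<le> B" and R: "1 \<le> R" and \<sigma>: "0 \<le> \<sigma>"
    and growth: "\<And>P. 1 \<le> P \<Longrightarrow> (LINT s:{-P..P}|lborel. cmod (G s)) \<le> 3 * N * P powr \<sigma>"
    and ie: "\<And>a b. set_integrable lborel {a..b} e"
    and phase: "\<And>a b \<rho>. R \<le> \<rho> \<Longrightarrow> (\<forall>t\<in>{a..b}. \<rho> \<le> \<bar>t\<bar>) \<Longrightarrow> cmod (LINT t:{a..b}|lborel. e t) \<le> B * \<rho> powr (- \<delta>)"
    and x: "2 * R \<le> \<bar>x\<bar>" and r: "0 < r"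
  shows "1 / (2 * r) * cmod (LINT t:{max (- r) (x - \<bar>x\<bar> / 2)..min r (x + \<bar>x\<bar> / 2)}|lborel. F (x - t) * e t)
    \<le> B * ((LINT z|lborel. cmod (F z)) + 3 * N) * (\<bar>x\<bar> / 2) powr (- 1 - (\<delta> - \<sigma>))"
proof -
  define P where "P = \<bar>x\<bar> / 2"
  define \<alpha> where "\<alpha> = max (- r) (x - P)"
  define \<beta> where "\<beta> = min r (x + P)"
  define A where "A = (LINT z|lborel. cmod (F z))"
  have P1: "1 \<le> P" and PR: "R \<le> P" using x R by (auto simp: P_def)
  have A0: "0 \<le> A" by (simp add: A_def)
  have rhs0: "0 \<le> B * (A + 3 * N) * P powr (- 1 - (\<delta> - \<sigma>))" using A0 B N by simp
  have "1 / (2 * r) * cmod (LINT t:{\<alpha>..\<beta>}|lborel. F (x - t) * e t) \<le> B * (A + 3 * N) * P powr (- 1 - (\<delta> - \<sigma>))"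
  proof (cases "\<alpha> \<le> \<beta>")
    case False
    then show ?thesis using rhs0 by (simp add: set_lebesgue_integral_def)
  next
    case True
    have Pr: "P \<le> r" using True by (auto simp: \<alpha>_def \<beta>_def P_def)
    have far: "\<forall>t\<in>{\<alpha>..\<beta>}. P \<le> \<bar>t\<bar>" by (auto simp: \<alpha>_def \<beta>_def P_def)
    define V where "V = (LINT s:{-P..P}|lborel. cmod (G s))"
    have V: "V \<le> 3 * N * P powr \<sigma>" unfolding V_def by (rule growth[OF P1])
    define M where "M = B * P powr (- \<delta>)"
    have M0: "0 \<le> M" using B by (simp add: M_def)
    have "cmod (LINT t:{\<alpha>..\<beta>}|lborel. F (x - t) * e t)
        \<le> (cmod (F (x - \<beta>)) + (LINT y:{x - \<beta>..x - \<alpha>}|lborel. cmod (G y))) * M"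
    proof (rule indefinite_integral_oscillation[OF G F ie True])
      show "cmod (LINT t:{\<alpha>..s}|lborel. e t) \<le> M" if "s \<in> {\<alpha>..\<beta>}" for s
        unfolding M_def by (rule phase[OF PR]) (use far that in auto)
    qed
    also have "\<dots> \<le> ((A / (2 * P) + V) + V) * M"
    proof (intro mult_right_mono add_mono M0)
      have "x - \<beta> \<in> {-P..P}" using True by (auto simp: \<alpha>_def \<beta>_def)
      then show "cmod (F (x - \<beta>)) \<le> A / (2 * P) + V"
        unfolding A_def V_def using P1 by (intro indefinite_integral_sup_bound[OF G F iF]) auto
      have i: "integrable lborel (\<lambda>s. indicator {-P..P} s *\<^sub>R cmod (G s))"
        using set_integrable_norm[OF G] by (simp add: set_integrable_def)
      show "(LINT y:{x - \<beta>..x - \<alpha>}|lborel. cmod (G y)) \<le> V"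
        unfolding V_def set_lebesgue_integral_def
        by (rule integral_mono'[OF i]) (auto simp: indicator_def \<alpha>_def \<beta>_def)
    qed
    also have "\<dots> \<le> (A / (2 * P) + 6 * N * P powr \<sigma>) * M"
      using V M0 by (intro mult_right_mono) auto
    finally have 1: "cmod (LINT t:{\<alpha>..\<beta>}|lborel. F (x - t) * e t) \<le> (A / (2 * P) + 6 * N * P powr \<sigma>) * M" .
    have "1 / (2 * r) * cmod (LINT t:{\<alpha>..\<beta>}|lborel. F (x - t) * e t)
        \<le> 1 / (2 * P) * ((A / (2 * P) + 6 * N * P powr \<sigma>) * M)"
      using 1 Pr P1 by (intro mult_mono frac_le) auto
    also have "\<dots> = (A / (4 * P) + 3 * N * P powr \<sigma>) * (M / P)"
      using P1 by (simp add: field_simps)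
    also have "\<dots> \<le> (A * P powr \<sigma> + 3 * N * P powr \<sigma>) * (M / P)"
    proof (intro mult_right_mono add_right_mono)
      have "A / (4 * P) \<le> A * 1" using A0 P1 by (intro order_trans[OF divide_left_mono[of 1 "4 * P" A]]) auto
      also have "\<dots> \<le> A * P powr \<sigma>" using A0 P1 \<sigma> by (intro mult_left_mono ge_one_powr_ge_zero) auto
      finally show "A / (4 * P) \<le> A * P powr \<sigma>" .
    qed (use M0 P1 in auto)
    also have "\<dots> = B * (A + 3 * N) * (P powr \<sigma> * P powr (- \<delta>) / P powr 1)"
      using P1 by (simp add: M_def algebra_simps)
    also have "P powr \<sigma> * P powr (- \<delta>) / P powr 1 = P powr (- 1 - (\<delta> - \<sigma>))"
      unfolding powr_add[symmetric] powr_diff[symmetric] by (simp add: algebra_simps)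
    finally show ?thesis .
  qed
  then show ?thesis by (simp add: A_def P_def \<alpha>_def \<beta>_def)
qed

definition far_term :: "real \<Rightarrow> real \<Rightarrow> real \<Rightarrow> real \<Rightarrow> real" where
  "far_term c R s x = (if 2 * R \<le> \<bar>x\<bar> then c * (\<bar>x\<bar> / 2) powr (- s) else 0)"

text \<open>Radii up to \<open>1 / weight l x\<close> are controlled by the value of \<open>F\<close> at \<open>x\<close> and its variation nearby.
  For larger radii the piece \<open>\<bar>t - x\<bar> \<le> \<bar>x\<bar> / 2\<close> is split off when \<open>\<bar>x\<bar> \<ge> 2 * R\<close>; off this piece
  \<open>\<bar>x\<bar> < 2 * \<bar>x - t\<bar>\<close>, whence \<open>\<bar>t\<bar> \<le> 3 * \<bar>x - t\<bar>\<close>, and the kernel bound applies.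
  The right-hand side does not depend on the radius.\<close>

lemma maximal_average_pointwise:
  fixes F G e :: "real \<Rightarrow> complex"
  assumes G: "\<And>a b. set_integrable lborel {a..b} G"
    and F: "\<And>x y. x \<le> y \<Longrightarrow> F y - F x = (LINT s:{x..y}|lborel. G s)"
    and iF: "integrable lborel F"
    and N: "0 \<le> N" and B: "0 \<le> B" and R: "1 \<le> R" and \<sigma>: "0 \<le> \<sigma>"
    and growth: "\<And>P. 1 \<le> P \<Longrightarrow> (LINT s:{-P..P}|lborel. cmod (G s)) \<le> 3 * N * P powr \<sigma>"
    and em [measurable]: "e \<in> borel_measurable borel" and e1: "\<And>t. cmod (e t) \<le> 1"
    and phase: "\<And>a b \<rho>. R \<le> \<rho> \<Longrightarrow> (\<forall>t\<in>{a..b}. \<rho> \<le> \<bar>t\<bar>) \<Longrightarrow> cmod (LINT t:{a..b}|lborel. e t) \<le> B * \<rho> powr (- \<delta>)"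
    and r: "0 < r"
  shows "ennreal (1 / (2 * r) * cmod (LINT t:{-r..r}|lborel. F (x - t) * e t))
    \<le> ennreal (cmod (F x)) + (\<integral>\<^sup>+y. ennreal (cmod (G y)) * indicator {x - 1 / weight l x..x + 1 / weight l x} y \<partial>lborel)
      + (\<integral>\<^sup>+y. ennreal (schur_kernel l R x y * cmod (F y)) \<partial>lborel)
      + ennreal (far_term (B * ((LINT z|lborel. cmod (F z)) + 3 * N)) R (1 + (\<delta> - \<sigma>)) x)"
    (is "?lhs \<le> ennreal (cmod (F x)) + ?V + ?K + ennreal ?O")
proof -
  have [measurable]: "F \<in> borel_measurable borel" using iF by auto
  have iFx: "integrable lborel (\<lambda>t. F (x - t) * e t)"
  proof (rule Bochner_Integration.integrable_bound)
    show "integrable lborel (\<lambda>t. F (x - t))"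
      using lborel_integrable_real_affine[OF iF, of "-1" x] by simp
    show "AE t in lborel. norm (F (x - t) * e t) \<le> norm (F (x - t))"
      using mult_left_mono[OF e1, of "cmod (F (x - _))"] by (intro AE_I2) (simp add: norm_mult)
  qed measurable
  have iS: "set_integrable lborel S (\<lambda>t. F (x - t) * e t)" if "S \<in> sets borel" for S
    using integrable_mult_indicator[OF _ iFx, of S] that by (simp add: set_integrable_def)
  have ie: "set_integrable lborel {a..b} e" for a b
    unfolding set_integrable_def
  proof (rule Bochner_Integration.integrable_bound)
    show "integrable lborel (\<lambda>t. indicator {a..b} t *\<^sub>R (1::real))"
      using borel_integrable_atLeastAtMost'[of a b "\<lambda>_. 1::real"] by (simp add: set_integrable_def)
    show "AE t in lborel. norm (indicator {a..b} t *\<^sub>R e t) \<le> norm (indicator {a..b} t *\<^sub>R (1::real))"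
      using e1 by (intro AE_I2) (auto simp: indicator_def)
  qed measurable
  show ?thesis
  proof (cases "r \<le> 1 / weight l x")
    case True
    have "?lhs \<le> ennreal (cmod (F x) + (LINT s:{x - r..x + r}|lborel. cmod (G s)))"
      by (intro ennreal_leI average_le_value_plus_variation[OF G F e1 r])
    also have "\<dots> = ennreal (cmod (F x)) + ennreal (LINT s:{x - r..x + r}|lborel. cmod (G s))"
      by (intro ennreal_plus) (auto simp: set_lebesgue_integral_def)
    also have "ennreal (LINT s:{x - r..x + r}|lborel. cmod (G s)) = (\<integral>\<^sup>+y. ennreal (cmod (G y)) * indicator {x - r..x + r} y \<partial>lborel)"
    proof -
      have i: "integrable lborel (\<lambda>s. indicator {x - r..x + r} s *\<^sub>R cmod (G s))"
        using set_integrable_norm[OF G] by (simp add: set_integrable_def)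
      show ?thesis
        unfolding set_lebesgue_integral_def
        by (subst nn_integral_eq_integral[OF i, symmetric]) (auto intro!: nn_integral_cong simp: indicator_def)
    qed
    also have "\<dots> \<le> ?V"
      using True by (intro nn_integral_mono) (auto simp: indicator_def)
    finally have "?lhs \<le> ennreal (cmod (F x)) + ?V" by (simp add: add_left_mono)
    then show ?thesis by (simp add: add_increasing2)
  next
    case False
    then have rw: "1 / weight l x < r" by simp
    show ?thesis
    proof (cases "2 * R \<le> \<bar>x\<bar>")
      case False
      have "?lhs \<le> ?K"
        by (rule average_le_schur_kernel[OF _ _ e1 rw]) (use False in \<open>auto intro!: iS\<close>)
      then show ?thesis by (simp add: add_increasing add_increasing2)
    next
      case True
      \<comment> \<open>The part of the interval on which the phase oscillates; it is empty for small radii.\<close>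
      define I where "I = {max (- r) (x - \<bar>x\<bar> / 2)..min r (x + \<bar>x\<bar> / 2)}"
      define S where "S = {-r..r} - I"
      have [measurable]: "I \<in> sets borel" "S \<in> sets borel" by (auto simp: I_def S_def)
      have "(LINT t:{-r..r}|lborel. F (x - t) * e t) = (LINT t:I \<union> S|lborel. F (x - t) * e t)"
        by (rule arg_cong[where f = "\<lambda>A. set_lebesgue_integral lborel A _"]) (auto simp: I_def S_def)
      also have "\<dots> = (LINT t:I|lborel. F (x - t) * e t) + (LINT t:S|lborel. F (x - t) * e t)"
        by (rule set_integral_Un) (auto simp: S_def intro!: iS)
      finally have "cmod (LINT t:{-r..r}|lborel. F (x - t) * e t) \<le> cmod (LINT t:I|lborel. F (x - t) * e t) + cmod (LINT t:S|lborel. F (x - t) * e t)"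
        by (simp add: norm_triangle_ineq)
      then have "1 / (2 * r) * cmod (LINT t:{-r..r}|lborel. F (x - t) * e t)
          \<le> 1 / (2 * r) * cmod (LINT t:I|lborel. F (x - t) * e t) + 1 / (2 * r) * cmod (LINT t:S|lborel. F (x - t) * e t)"
        using r by (simp add: distrib_left[symmetric] mult_left_mono del: times_divide_eq_left)
      then have "?lhs \<le> ennreal (1 / (2 * r) * cmod (LINT t:I|lborel. F (x - t) * e t) + 1 / (2 * r) * cmod (LINT t:S|lborel. F (x - t) * e t))"
        by (rule ennreal_leI)
      also have "\<dots> = ennreal (1 / (2 * r) * cmod (LINT t:I|lborel. F (x - t) * e t)) + ennreal (1 / (2 * r) * cmod (LINT t:S|lborel. F (x - t) * e t))"
        using r by (intro ennreal_plus) auto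
      also have "\<dots> \<le> ennreal ?O + ?K"
      proof (rule add_mono)
        have ex: "- 1 - (\<delta> - \<sigma>) = - (1 + (\<delta> - \<sigma>))" by simp
        show "ennreal (1 / (2 * r) * cmod (LINT t:I|lborel. F (x - t) * e t)) \<le> ennreal ?O"
          unfolding I_def far_term_def if_P[OF True]
          by (rule ennreal_leI) (rule far_oscillation_bound[OF G F iF N B R \<sigma> growth ie phase True r, unfolded ex])
        show "ennreal (1 / (2 * r) * cmod (LINT t:S|lborel. F (x - t) * e t)) \<le> ?K"
          by (rule average_le_schur_kernel[OF _ _ e1 rw]) (auto simp: S_def I_def intro!: iS)
      qed
      also have "\<dots> = ?K + ennreal ?O" by (rule add.commute)
      also have "\<dots> \<le> ennreal (cmod (F x)) + ?V + ?K + ennreal ?O"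
        by (intro add_right_mono) (simp add: add_increasing)
      finally show ?thesis .
    qed
  qed
qed

section \<open>Integrating the pointwise bound\<close>

lemma nn_integral_powr_tail:
  assumes s: "1 < s"
  shows "(\<integral>\<^sup>+x. ennreal (x powr (- s)) * indicator {1::real..} x \<partial>lborel) = ennreal (1 / (s - 1))"
proof -
  have "(\<integral>\<^sup>+x. ennreal (x powr (- s)) * indicator {1::real..} x \<partial>lborel) = ennreal (0 - (- (1 powr (1 - s) / (s - 1))))"
  proof (rule nn_integral_FTC_atLeast[where F = "\<lambda>x. - (x powr (1 - s) / (s - 1))"])
    show "((\<lambda>x. - (x powr (1 - s) / (s - 1))) has_real_derivative x powr (- s)) (at x)" if "1 \<le> x" for x
    proof -
      have "((\<lambda>x. - (x powr (1 - s) / (s - 1))) has_real_derivative - ((1 - s) * x powr (1 - s - 1) / (s - 1))) (at x)"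
        using that by (intro DERIV_minus DERIV_cdivide has_real_derivative_powr) auto
      also have "- ((1 - s) * x powr (1 - s - 1) / (s - 1)) = x powr (- s)"
        using s by (simp add: field_simps)
      finally show ?thesis .
    qed
    show "0 \<le> x powr (- s)" for x by simp
    have "((\<lambda>x. - (x powr (1 - s) / (s - 1))) \<longlongrightarrow> - (0 / (s - 1))) at_top"
      using s by (intro tendsto_intros tendsto_neg_powr filterlim_ident) auto
    then show "((\<lambda>x. - (x powr (1 - s) / (s - 1))) \<longlongrightarrow> 0) at_top" by simp
  qed auto
  then show ?thesis by simp
qed

lemma nn_integral_abs_powr_tail:
  assumes s: "1 < s"
  shows "(\<integral>\<^sup>+x. ennreal (\<bar>x\<bar> powr (- s)) * indicator {x. 1 \<le> \<bar>x::real\<bar>} x \<partial>lborel) = ennreal (2 / (s - 1))"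
proof -
  let ?f = "\<lambda>x::real. ennreal (x powr (- s)) * indicator {1..} x"
  have "(\<integral>\<^sup>+x. ennreal (\<bar>x\<bar> powr (- s)) * indicator {x. 1 \<le> \<bar>x::real\<bar>} x \<partial>lborel) = (\<integral>\<^sup>+x. ?f x + ?f (0 - x) \<partial>lborel)"
    by (intro nn_integral_cong) (auto simp: indicator_def abs_if)
  also have "\<dots> = (\<integral>\<^sup>+x. ?f x \<partial>lborel) + (\<integral>\<^sup>+x. ?f (0 - x) \<partial>lborel)"
    by (rule nn_integral_add) measurable
  also have "(\<integral>\<^sup>+x. ?f (0 - x) \<partial>lborel) = (\<integral>\<^sup>+x. ?f x \<partial>lborel)"
    by (rule nn_integral_reflect) measurable
  also have "(\<integral>\<^sup>+x. ?f x \<partial>lborel) = ennreal (1 / (s - 1))" by (rule nn_integral_powr_tail[OF s])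
  also have "ennreal (1 / (s - 1)) + ennreal (1 / (s - 1)) = ennreal (2 / (s - 1))"
    using s by (simp add: ennreal_plus[symmetric] add_divide_distrib[symmetric] del: ennreal_plus)
  finally show ?thesis .
qed

text \<open>Here \<open>l > 1\<close> is essential: the reciprocal of the weight serves as the threshold radius, and
  it has to be integrable.\<close>

lemma nn_integral_inverse_weight:
  assumes l: "1 < l"
  shows "(\<integral>\<^sup>+x. ennreal (1 / weight l x) \<partial>lborel) \<le> ennreal (2 + 2 / (l - 1))"
proof -
  have "(\<integral>\<^sup>+x. ennreal (1 / weight l x) \<partial>lborel) \<le>
      (\<integral>\<^sup>+x. indicator {-1..1} x + ennreal (\<bar>x\<bar> powr (- l)) * indicator {x. 1 \<le> \<bar>x::real\<bar>} x \<partial>lborel)"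
  proof (rule nn_integral_mono)
    fix x :: real
    show "ennreal (1 / weight l x) \<le> indicator {-1..1} x + ennreal (\<bar>x\<bar> powr (- l)) * indicator {x. 1 \<le> \<bar>x::real\<bar>} x"
    proof (cases "\<bar>x\<bar> \<le> 1")
      case True
      have "ennreal (1 / weight l x) \<le> 1"
        using weight_ge_1[of l x] weight_pos[of l x] by simp
      moreover have "x \<in> {-1..1}" using True by auto
      ultimately show ?thesis by (simp add: add_increasing2)
    next
      case False
      have "1 / weight l x \<le> 1 / \<bar>x\<bar> powr l"
        using False by (intro divide_left_mono) (auto simp: weight_def add_pos_pos)
      also have "\<dots> = \<bar>x\<bar> powr (- l)" by (simp add: powr_minus divide_inverse)
      finally show ?thesis using False by (simp add: ennreal_leI add_increasing)
    qed
  qed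
  also have "\<dots> = (\<integral>\<^sup>+x. indicator {-1..1::real} x \<partial>lborel) + (\<integral>\<^sup>+x. ennreal (\<bar>x\<bar> powr (- l)) * indicator {x. 1 \<le> \<bar>x::real\<bar>} x \<partial>lborel)"
    by (rule nn_integral_add) measurable
  also have "\<dots> = ennreal 2 + ennreal (2 / (l - 1))"
    by (simp add: nn_integral_abs_powr_tail[OF l])
  also have "\<dots> = ennreal (2 + 2 / (l - 1))" using l by simp
  finally show ?thesis .
qed

lemma nn_integral_far_term:
  assumes s: "1 < s" and R: "1 \<le> R" and c: "0 \<le> c"
  shows "(\<integral>\<^sup>+x. ennreal (far_term c R s x) \<partial>lborel) \<le> ennreal (c * (4 / (s - 1)))"
proof -
  let ?g = "\<lambda>x::real. ennreal (\<bar>x\<bar> powr (- s)) * indicator {x. 1 \<le> \<bar>x\<bar>} x"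
  have "(\<integral>\<^sup>+x. ennreal (far_term c R s x) \<partial>lborel) \<le> (\<integral>\<^sup>+x. ennreal c * ?g (0 + 1 / 2 * x) \<partial>lborel)"
    using R c by (intro nn_integral_mono) (auto simp: far_term_def indicator_def ennreal_mult abs_mult)
  also have "\<dots> = ennreal c * (\<integral>\<^sup>+x. ?g (0 + 1 / 2 * x) \<partial>lborel)"
    by (rule nn_integral_cmult) measurable
  also have "(\<integral>\<^sup>+x. ?g (0 + 1 / 2 * x) \<partial>lborel) = ennreal (4 / (s - 1))"
  proof -
    have "ennreal (2 / (s - 1)) = ennreal \<bar>1 / 2\<bar> * (\<integral>\<^sup>+x. ?g (0 + 1 / 2 * x) \<partial>lborel)"
      unfolding nn_integral_abs_powr_tail[OF s, symmetric]
    proof (rule nn_integral_real_affine)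
      have [measurable]: "{x::real. 1 \<le> \<bar>x\<bar>} \<in> sets borel" by measurable
      show "?g \<in> borel_measurable borel" by measurable
    qed simp
    then have "ennreal 2 * ennreal (2 / (s - 1)) = ennreal 2 * ennreal (1 / 2) * (\<integral>\<^sup>+x. ?g (0 + 1 / 2 * x) \<partial>lborel)"
      by (simp add: mult.assoc)
    also have "ennreal 2 * ennreal (1 / 2) = ennreal (2 * (1 / 2))" by (rule ennreal_mult'[symmetric]) simp
    also have "ennreal 2 * ennreal (2 / (s - 1)) = ennreal (4 / (s - 1))"
      by (simp add: ennreal_mult'[symmetric] del: ennreal_numeral)
    finally show ?thesis by simp
  qed
  also have "ennreal c * ennreal (4 / (s - 1)) = ennreal (c * (4 / (s - 1)))"
    using c by (rule ennreal_mult'[symmetric])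
  finally show ?thesis .
qed

lemma abs_le_weight: "1 \<le> l \<Longrightarrow> \<bar>y\<bar> \<le> weight l y"
proof (cases "\<bar>y\<bar> \<le> 1")
  case False
  assume "1 \<le> l"
  then have "\<bar>y\<bar> powr 1 \<le> \<bar>y\<bar> powr l" using False by (intro powr_mono) auto
  then show ?thesis using False by (simp add: weight_def)
qed (use weight_ge_1[of l y] in linarith)

lemma weight_slowly_varying:
  assumes l: "0 \<le> l" "l \<le> 2" and xy: "\<bar>x - y\<bar> \<le> 1"
  shows "weight l x \<le> 5 * weight l y"
proof -
  have "\<bar>x\<bar> powr l \<le> (2 * max 1 \<bar>y\<bar>) powr l"
    using xy l by (intro powr_mono2) auto
  also have "\<dots> = 2 powr l * max 1 \<bar>y\<bar> powr l" by (rule powr_mult)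
  also have "\<dots> \<le> 2 powr 2 * (1 + \<bar>y\<bar> powr l)"
    using l by (intro mult_mono powr_mono) (auto simp: max_def)
  finally show ?thesis
    by (simp add: weight_def) (use powr_ge_zero[of "\<bar>y\<bar>" l] in linarith)
qed

text \<open>The second term of the kernel contributes the length \<open>6 * \<bar>y\<bar>\<close>, which the weight absorbs
  because \<open>l \<ge> 1\<close>. In the first term the weight at \<open>x\<close> is exchanged for the weight at \<open>y\<close>.\<close>

lemma nn_integral_schur_kernel:
  assumes l: "1 \<le> l" "l \<le> 2" and R: "0 \<le> R"
  shows "(\<integral>\<^sup>+x. ennreal (schur_kernel l R x y) \<partial>lborel) \<le> ennreal ((16 + 4 * R) * weight l y)"
proof -
  have "(\<integral>\<^sup>+x. ennreal (schur_kernel l R x y) \<partial>lborel) \<le>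
     (\<integral>\<^sup>+x. ennreal (5 * weight l y) * indicator {y - 1..y + 1} x + (indicator {y - 3 * \<bar>y\<bar>..y + 3 * \<bar>y\<bar>} x + indicator {- (2 * R)..2 * R} x) \<partial>lborel)"
  proof (rule nn_integral_mono)
    fix x
    have "schur_kernel l R x y \<le> 5 * weight l y * indicator {y - 1..y + 1} x + (indicator {y - 3 * \<bar>y\<bar>..y + 3 * \<bar>y\<bar>} x + indicator {- (2 * R)..2 * R} x)"
      using weight_slowly_varying[of l x y] l weight_ge_1[of l y]
      by (auto simp: schur_kernel_def indicator_def abs_le_iff)
    also have "ennreal \<dots> = ennreal (5 * weight l y) * indicator {y - 1..y + 1} x + (indicator {y - 3 * \<bar>y\<bar>..y + 3 * \<bar>y\<bar>} x + indicator {- (2 * R)..2 * R} x)"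
      using weight_ge_1[of l y] by (simp add: ennreal_mult' ennreal_indicator)
    finally show "ennreal (schur_kernel l R x y) \<le> ennreal (5 * weight l y) * indicator {y - 1..y + 1} x + (indicator {y - 3 * \<bar>y\<bar>..y + 3 * \<bar>y\<bar>} x + indicator {- (2 * R)..2 * R} x)"
      by (simp add: ennreal_leI)
  qed
  also have "\<dots> = ennreal (5 * weight l y) * ennreal 2 + (ennreal (6 * \<bar>y\<bar>) + ennreal (4 * R))"
    using R by (simp add: nn_integral_add nn_integral_cmult)
  also have "\<dots> = ennreal (5 * weight l y * 2 + (6 * \<bar>y\<bar> + 4 * R))"
  proof -
    have "ennreal a * ennreal 2 + (ennreal b + ennreal c) = ennreal (a * 2 + (b + c))" if "0 \<le> a" "0 \<le> b" "0 \<le> c" for a b c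
      using that by (simp add: ennreal_mult)
    then show ?thesis using R weight_pos[of l y] by auto
  qed
  also have "\<dots> \<le> ennreal ((16 + 4 * R) * weight l y)"
  proof (rule ennreal_leI)
    have "R * 1 \<le> R * weight l y" using R weight_ge_1 by (intro mult_left_mono)
    with abs_le_weight[OF l(1), of y] show "5 * weight l y * 2 + (6 * \<bar>y\<bar> + 4 * R) \<le> (16 + 4 * R) * weight l y"
      by (simp add: algebra_simps)
  qed
  finally show ?thesis .
qed

lemma schur_test:
  assumes l: "1 \<le> l" "l \<le> 2" and R: "0 \<le> R" and [measurable]: "F \<in> borel_measurable borel"
  shows "(\<integral>\<^sup>+x. (\<integral>\<^sup>+y. ennreal (schur_kernel l R x y * cmod (F y)) \<partial>lborel) \<partial>lborel)
    \<le> ennreal (16 + 4 * R) * (\<integral>\<^sup>+y. ennreal (weight l y * cmod (F y)) \<partial>lborel)"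
proof -
  have "(\<integral>\<^sup>+x. (\<integral>\<^sup>+y. ennreal (schur_kernel l R x y * cmod (F y)) \<partial>lborel) \<partial>lborel)
      = (\<integral>\<^sup>+y. (\<integral>\<^sup>+x. ennreal (schur_kernel l R x y * cmod (F y)) \<partial>lborel) \<partial>lborel)"
    by (rule lborel_pair.Fubini') measurable
  also have "\<dots> = (\<integral>\<^sup>+y. (\<integral>\<^sup>+x. ennreal (schur_kernel l R x y) \<partial>lborel) * ennreal (cmod (F y)) \<partial>lborel)"
    by (intro nn_integral_cong, subst nn_integral_multc[symmetric])
      (simp_all add: ennreal_mult schur_kernel_nonneg)
  also have "\<dots> \<le> (\<integral>\<^sup>+y. ennreal (16 + 4 * R) * ennreal (weight l y * cmod (F y)) \<partial>lborel)"
  proof (rule nn_integral_mono)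
    fix y
    have "(\<integral>\<^sup>+x. ennreal (schur_kernel l R x y) \<partial>lborel) * ennreal (cmod (F y)) \<le> ennreal ((16 + 4 * R) * weight l y) * ennreal (cmod (F y))"
      by (intro mult_right_mono nn_integral_schur_kernel l R) simp
    also have "\<dots> = ennreal (16 + 4 * R) * ennreal (weight l y * cmod (F y))"
      using R weight_pos[of l y] by (simp add: ennreal_mult'[symmetric] mult.assoc del: ennreal_plus)
    finally show "(\<integral>\<^sup>+x. ennreal (schur_kernel l R x y) \<partial>lborel) * ennreal (cmod (F y)) \<le> ennreal (16 + 4 * R) * ennreal (weight l y * cmod (F y))" .
  qed
  also have "\<dots> = ennreal (16 + 4 * R) * (\<integral>\<^sup>+y. ennreal (weight l y * cmod (F y)) \<partial>lborel)"
    by (rule nn_integral_cmult) measurable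
  finally show ?thesis .
qed

text \<open>The two parts of \<open>G\<close> are treated differently: the bounded part is integrated over an
  interval of length \<open>2 / weight l x\<close>, which is integrable in \<open>x\<close>; for the integrable part \<open>h\<close> the interval
  is enlarged to length \<open>2\<close>.\<close>

lemma local_variation_integral:
  assumes l: "1 < l" and [measurable]: "G \<in> borel_measurable borel" "h \<in> borel_measurable borel"
    and Gh: "AE y in lborel. ennreal (cmod (G y)) \<le> ennreal N * (1 + h y)"
    and h: "(\<integral>\<^sup>+y. h y \<partial>lborel) \<le> 1" and N: "0 \<le> N"
  shows "(\<integral>\<^sup>+x. (\<integral>\<^sup>+y. ennreal (cmod (G y)) * indicator {x - 1 / weight l x..x + 1 / weight l x} y \<partial>lborel) \<partial>lborel)
    \<le> ennreal (N * (6 + 4 / (l - 1)))"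
proof -
  let ?\<rho> = "\<lambda>x. 1 / weight l x"
  let ?k = "\<lambda>x y. if \<bar>x - y\<bar> \<le> 1 then h y else (0::ennreal)"
  have [measurable]: "(\<lambda>(x, y). ?k x y) \<in> borel_measurable (borel \<Otimes>\<^sub>M borel)" by measurable
  have k: "(\<integral>\<^sup>+x. (\<integral>\<^sup>+y. ?k x y \<partial>lborel) \<partial>lborel) \<le> 2"
  proof -
    have "(\<integral>\<^sup>+x. (\<integral>\<^sup>+y. ?k x y \<partial>lborel) \<partial>lborel) = (\<integral>\<^sup>+y. (\<integral>\<^sup>+x. ?k x y \<partial>lborel) \<partial>lborel)"
      by (rule lborel_pair.Fubini') measurable
    also have "\<dots> = (\<integral>\<^sup>+y. (\<integral>\<^sup>+x. h y * indicator {y - 1..y + 1} x \<partial>lborel) \<partial>lborel)"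
      by (intro nn_integral_cong) (auto simp: indicator_def)
    also have "\<dots> = (\<integral>\<^sup>+y. h y * 2 \<partial>lborel)" by (simp add: nn_integral_cmult)
    also have "\<dots> = (\<integral>\<^sup>+y. h y \<partial>lborel) * 2" by (rule nn_integral_multc) measurable
    also have "\<dots> \<le> 1 * 2" by (intro mult_right_mono h) simp
    finally show ?thesis by simp
  qed
  have "(\<integral>\<^sup>+y. ennreal (cmod (G y)) * indicator {x - ?\<rho> x..x + ?\<rho> x} y \<partial>lborel)
      \<le> ennreal N * (ennreal (2 * ?\<rho> x) + (\<integral>\<^sup>+y. ?k x y \<partial>lborel))" for x
  proof -
    have \<rho>: "0 \<le> ?\<rho> x" "?\<rho> x \<le> 1" using weight_ge_1[of l x] weight_pos[of l x] by auto
    have "(\<integral>\<^sup>+y. ennreal (cmod (G y)) * indicator {x - ?\<rho> x..x + ?\<rho> x} y \<partial>lborel)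
       \<le> (\<integral>\<^sup>+y. ennreal N * (indicator {x - ?\<rho> x..x + ?\<rho> x} y + ?k x y) \<partial>lborel)"
    proof (rule nn_integral_mono_AE)
      show "AE y in lborel. ennreal (cmod (G y)) * indicator {x - ?\<rho> x..x + ?\<rho> x} y \<le> ennreal N * (indicator {x - ?\<rho> x..x + ?\<rho> x} y + ?k x y)"
        using Gh
      proof eventually_elim
        case (elim y)
        show ?case
        proof (cases "y \<in> {x - ?\<rho> x..x + ?\<rho> x}")
          case True
          then have "\<bar>x - y\<bar> \<le> 1" using \<rho> by (auto simp: abs_le_iff)
          with True elim show ?thesis by simp
        qed simp
      qed
    qed
    also have "\<dots> = ennreal N * ((\<integral>\<^sup>+y. indicator {x - ?\<rho> x..x + ?\<rho> x} y \<partial>lborel) + (\<integral>\<^sup>+y. ?k x y \<partial>lborel))"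
      by (subst nn_integral_cmult, measurable, subst nn_integral_add, measurable)
    also have "(\<integral>\<^sup>+y. indicator {x - ?\<rho> x..x + ?\<rho> x} y \<partial>lborel) = ennreal (2 * ?\<rho> x)"
      using \<rho> by (simp del: times_divide_eq_right)
    finally show ?thesis .
  qed
  then have "(\<integral>\<^sup>+x. (\<integral>\<^sup>+y. ennreal (cmod (G y)) * indicator {x - ?\<rho> x..x + ?\<rho> x} y \<partial>lborel) \<partial>lborel)
      \<le> (\<integral>\<^sup>+x. ennreal N * (ennreal 2 * ennreal (?\<rho> x) + (\<integral>\<^sup>+y. ?k x y \<partial>lborel)) \<partial>lborel)"
    by (intro nn_integral_mono) (simp add: ennreal_mult'[symmetric] del: ennreal_numeral)
  also have "\<dots> = ennreal N * (ennreal 2 * (\<integral>\<^sup>+x. ennreal (?\<rho> x) \<partial>lborel) + (\<integral>\<^sup>+x. (\<integral>\<^sup>+y. ?k x y \<partial>lborel) \<partial>lborel))"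
    by (subst nn_integral_cmult, measurable, subst nn_integral_add, measurable, subst nn_integral_cmult, measurable)
  also have "\<dots> \<le> ennreal N * (ennreal 2 * ennreal (2 + 2 / (l - 1)) + ennreal 2)"
    using k by (intro mult_left_mono add_mono nn_integral_inverse_weight l) auto
  also have "\<dots> = ennreal (N * (6 + 4 / (l - 1)))"
    using l N by (simp add: ennreal_mult'[symmetric] ennreal_plus[symmetric] algebra_simps del: ennreal_numeral ennreal_plus)
  finally show ?thesis .
qed

text \<open>The four terms of the pointwise bound are integrated separately. The split of \<open>G\<close> into a
  bounded and an integrable part, and the growth exponent \<open>\<sigma>\<close>, are all that is needed to know about
  the derivative.\<close>

lemma osc_maximal_integral_bound:
  fixes F G :: "real \<Rightarrow> complex" and \<theta> :: "real \<times> real \<Rightarrow> real"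
  assumes l: "1 < l" "l < 2"
    and Gm [measurable]: "G \<in> borel_measurable borel" and hm [measurable]: "h \<in> borel_measurable borel"
    and G: "\<And>a b. set_integrable lborel {a..b} G"
    and F: "\<And>x y. x \<le> y \<Longrightarrow> F y - F x = (LINT s:{x..y}|lborel. G s)"
    and Fm [measurable]: "F \<in> borel_measurable borel"
    and W: "(\<integral>\<^sup>+y. ennreal (weight l y * cmod (F y)) \<partial>lborel) < \<infinity>"
    and N: "0 \<le> N" and B: "0 \<le> B" and R: "1 \<le> R" and \<sigma>: "0 \<le> \<sigma>" "\<sigma> < \<delta>"
    and Gh: "AE y in lborel. ennreal (cmod (G y)) \<le> ennreal N * (1 + h y)"
    and h: "(\<integral>\<^sup>+y. h y \<partial>lborel) \<le> 1"
    and growth: "\<And>P. 1 \<le> P \<Longrightarrow> (LINT s:{-P..P}|lborel. cmod (G s)) \<le> 3 * N * P powr \<sigma>"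
    and \<theta>: "\<And>x. (\<lambda>t. \<theta> (x, t)) \<in> borel_measurable borel"
    and phase: "AE x in lborel. \<forall>a b \<rho>. R \<le> \<rho> \<longrightarrow> (\<forall>t\<in>{a..b}. \<rho> \<le> \<bar>t\<bar>) \<longrightarrow>
        cmod (LINT t:{a..b}|lborel. exp (\<i> * complex_of_real (\<theta> (x, t)))) \<le> B * \<rho> powr (- \<delta>)"
  shows "(\<integral>\<^sup>+x. osc_maximal \<theta> F x \<partial>lborel)
    \<le> ennreal (23 + 4 * R + 4 / (l - 1) + 12 * B / (\<delta> - \<sigma>)) *
      ((\<integral>\<^sup>+y. ennreal (weight l y * cmod (F y)) \<partial>lborel) + ennreal N)"
proof -
  obtain w where w: "(\<integral>\<^sup>+y. ennreal (weight l y * cmod (F y)) \<partial>lborel) = ennreal w" "0 \<le> w"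
    using W by (cases "\<integral>\<^sup>+y. ennreal (weight l y * cmod (F y)) \<partial>lborel") auto
  have Fw: "(\<integral>\<^sup>+y. ennreal (cmod (F y)) \<partial>lborel) \<le> ennreal w"
    unfolding w(1)[symmetric]
    by (intro nn_integral_mono ennreal_leI) (use mult_right_mono[OF weight_ge_1 norm_ge_zero] in simp)
  have iF: "integrable lborel F"
    using Fw by (intro integrableI_bounded) (auto intro: le_less_trans)
  have A: "(LINT z|lborel. cmod (F z)) \<le> w"
  proof -
    have "ennreal (LINT z|lborel. cmod (F z)) = (\<integral>\<^sup>+y. ennreal (cmod (F y)) \<partial>lborel)"
      using iF by (intro nn_integral_eq_integral[symmetric]) auto
    with Fw w(2) show ?thesis by (metis ennreal_le_iff)
  qed
  define c where "c = B * ((LINT z|lborel. cmod (F z)) + 3 * N)"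
  have c: "0 \<le> c" using B N by (simp add: c_def)
  define V where "V x = (\<integral>\<^sup>+y. ennreal (cmod (G y)) * indicator {x - 1 / weight l x..x + 1 / weight l x} y \<partial>lborel)" for x
  define K where "K x = (\<integral>\<^sup>+y. ennreal (schur_kernel l R x y * cmod (F y)) \<partial>lborel)" for x
  define T where "T = far_term c R (1 + (\<delta> - \<sigma>))"
  have V': "V x = (\<integral>\<^sup>+y. (if \<bar>x - y\<bar> \<le> 1 / weight l x then ennreal (cmod (G y)) else 0) \<partial>lborel)" for x
    unfolding V_def by (intro nn_integral_cong) (auto simp: indicator_def abs_le_iff)
  have [measurable]: "V \<in> borel_measurable borel" unfolding V'[abs_def] by measurable
  have [measurable]: "K \<in> borel_measurable borel" unfolding K_def[abs_def] by measurable
  have [measurable]: "T \<in> borel_measurable borel" unfolding T_def far_term_def[abs_def] by measurable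
  have pointwise: "AE x in lborel. osc_maximal \<theta> F x \<le> ennreal (cmod (F x)) + V x + K x + ennreal (T x)"
    using phase
  proof eventually_elim
    case (elim x)
    define e where "e t = exp (\<i> * complex_of_real (\<theta> (x, t)))" for t
    have [measurable]: "e \<in> borel_measurable borel" unfolding e_def[abs_def] using \<theta>[of x] by measurable
    show ?case
      unfolding osc_maximal_def
    proof (rule SUP_least)
      fix r :: real assume "r \<in> {0<..}"
      then have r: "0 < r" by simp
      have "(LINT t:{-r..r}|lebesgue. F (x - t) * e t) = (LINT t:{-r..r}|lborel. F (x - t) * e t)"
        unfolding set_lebesgue_integral_def by (rule integral_completion) measurable
      moreover have "ennreal (1 / (2 * r) * cmod (LINT t:{-r..r}|lborel. F (x - t) * e t)) \<le> ennreal (cmod (F x)) + V x + K x + ennreal (T x)"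
        unfolding V_def K_def T_def c_def
      proof (rule maximal_average_pointwise[OF G F iF N B R \<sigma>(1) growth _ _ _ r])
        show "cmod (e t) \<le> 1" for t by (simp add: e_def)
        show "cmod (LINT t:{a..b}|lborel. e t) \<le> B * \<rho> powr (- \<delta>)" if "R \<le> \<rho>" "\<forall>t\<in>{a..b}. \<rho> \<le> \<bar>t\<bar>" for a b \<rho>
          using elim that unfolding e_def by blast
      qed measurable
      ultimately show "ennreal (1 / (2 * r) * cmod (LINT t:{-r..r}|lebesgue. F (x - t) * exp (\<i> * complex_of_real (\<theta> (x, t)))))
          \<le> ennreal (cmod (F x)) + V x + K x + ennreal (T x)"
        by (simp add: e_def)
    qed
  qed
  have "(\<integral>\<^sup>+x. osc_maximal \<theta> F x \<partial>lborel) \<le> (\<integral>\<^sup>+x. ennreal (cmod (F x)) + V x + K x + ennreal (T x) \<partial>lborel)"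
    by (rule nn_integral_mono_AE[OF pointwise])
  also have "\<dots> = (\<integral>\<^sup>+x. ennreal (cmod (F x)) \<partial>lborel) + (\<integral>\<^sup>+x. V x \<partial>lborel) + (\<integral>\<^sup>+x. K x \<partial>lborel) + (\<integral>\<^sup>+x. ennreal (T x) \<partial>lborel)"
    by (simp add: nn_integral_add)
  also have "\<dots> \<le> ennreal w + ennreal (N * (6 + 4 / (l - 1))) + ennreal (16 + 4 * R) * ennreal w + ennreal (c * (4 / (1 + (\<delta> - \<sigma>) - 1)))"
  proof (intro add_mono Fw)
    show "(\<integral>\<^sup>+x. V x \<partial>lborel) \<le> ennreal (N * (6 + 4 / (l - 1)))"
      unfolding V_def by (rule local_variation_integral[OF l(1) Gm hm Gh h N])
    show "(\<integral>\<^sup>+x. K x \<partial>lborel) \<le> ennreal (16 + 4 * R) * ennreal w"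
      unfolding K_def w(1)[symmetric] using l R by (intro schur_test) auto
    show "(\<integral>\<^sup>+x. ennreal (T x) \<partial>lborel) \<le> ennreal (c * (4 / (1 + (\<delta> - \<sigma>) - 1)))"
      unfolding T_def using \<sigma> R c by (intro nn_integral_far_term) auto
  qed
  also have "\<dots> = ennreal (w + N * (6 + 4 / (l - 1)) + (16 + 4 * R) * w + c * (4 / (\<delta> - \<sigma>)))"
  proof -
    have sum: "ennreal a + ennreal b + ennreal d * ennreal e + ennreal f = ennreal (a + b + d * e + f)"
      if "0 \<le> a" "0 \<le> b" "0 \<le> d" "0 \<le> e" "0 \<le> f" for a b d e f
      using that by (simp add: ennreal_mult)
    have "1 + (\<delta> - \<sigma>) - 1 = \<delta> - \<sigma>" by simp
    then show ?thesis
      by (simp only:) (rule sum, use w(2) N R l \<sigma> c in auto)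
  qed
  \<comment> \<open>The four terms contribute \<open>1\<close>, \<open>6 + 4 / (l - 1)\<close>, \<open>16 + 4 * R\<close> and \<open>3 * B * (4 / (\<delta> - \<sigma>))\<close> to the constant.\<close>
  also have "\<dots> \<le> ennreal ((23 + 4 * R + 4 / (l - 1) + 12 * B / (\<delta> - \<sigma>)) * (w + N))"
  proof (rule ennreal_leI)
    define p where "p = 4 / (l - 1)"
    define q where "q = 4 / (\<delta> - \<sigma>)"
    have p: "0 \<le> p" and q: "0 \<le> q" using l \<sigma> by (auto simp: p_def q_def)
    have "c * q \<le> B * (3 * (w + N)) * q"
      unfolding c_def using A B q w(2) by (intro mult_right_mono mult_left_mono) auto
    moreover have "0 \<le> p * w" "0 \<le> R * N" "0 \<le> N" using p w(2) R N by auto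
    moreover have "12 * B / (\<delta> - \<sigma>) = 3 * (B * q)" by (simp add: q_def)
    ultimately show "w + N * (6 + 4 / (l - 1)) + (16 + 4 * R) * w + c * (4 / (\<delta> - \<sigma>))
        \<le> (23 + 4 * R + 4 / (l - 1) + 12 * B / (\<delta> - \<sigma>)) * (w + N)"
      unfolding p_def[symmetric] q_def[symmetric] using w(2) by (simp add: algebra_simps)
  qed
  also have "\<dots> = ennreal (23 + 4 * R + 4 / (l - 1) + 12 * B / (\<delta> - \<sigma>)) * (ennreal w + ennreal N)"
    using w(2) N R l \<sigma> B by (simp add: ennreal_mult del: ennreal_plus flip: ennreal_plus)
  finally show ?thesis by (simp add: w(1))
qed

section \<open>Splitting and growth of functions in a Lebesgue space\<close>

text \<open>For finite \<open>p\<close> both bounds come from \<open>v \<le> \<mu> + \<mu> powr (1 - p) * v powr p\<close> with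
  \<open>v = \<bar>G\<bar> / N\<close>: the choice \<open>\<mu> = 1\<close> gives the split with \<open>h = v powr p\<close>, and \<open>\<mu> = P powr (- 1 / p)\<close>
  gives the growth that Hoelder's inequality would give, up to the constant.\<close>

lemma Lp_norm_growth:
  fixes f' G :: "real \<Rightarrow> complex" and p :: ennreal
  assumes p: "1 \<le> p" and Gm [measurable]: "G \<in> borel_measurable borel"
    and G: "\<And>a b. set_integrable lborel {a..b} G"
    and fG: "AE y in lborel. f' y = G y" and norm: "Lp_norm p lebesgue f' = ennreal N" and N: "0 \<le> N"
  obtains h where "h \<in> borel_measurable borel" "AE y in lborel. ennreal (cmod (G y)) \<le> ennreal N * (1 + h y)"
    "(\<integral>\<^sup>+y. h y \<partial>lborel) \<le> 1"
    "\<And>P. 1 \<le> P \<Longrightarrow> (LINT s:{-P..P}|lborel. cmod (G s)) \<le> 3 * N * P powr (1 - (if p = \<infinity> then 0 else 1 / enn2real p))"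
proof -
  have c: "integrable lborel (\<lambda>z. indicator {a..b} z *\<^sub>R c)" for a b c :: real
    using borel_integrable_atLeastAtMost'[of a b "\<lambda>_. c"] by (simp add: set_integrable_def)
  have bdd: "(LINT s:{-P..P}|lborel. cmod (G s)) \<le> 2 * P * M" if "AE y in lborel. cmod (G y) \<le> M" "0 \<le> P" "0 \<le> M" for P M
  proof -
    have "(LINT s:{-P..P}|lborel. cmod (G s)) \<le> (LINT s|lborel. indicator {-P..P} s *\<^sub>R M)"
      unfolding set_lebesgue_integral_def
    proof (rule integral_mono_AE)
      show "integrable lborel (\<lambda>s. indicator {-P..P} s *\<^sub>R cmod (G s))"
        using set_integrable_norm[OF G] by (simp add: set_integrable_def)
      show "AE s in lborel. indicator {-P..P} s *\<^sub>R cmod (G s) \<le> indicator {-P..P} s *\<^sub>R M"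
        using that(1) by eventually_elim (auto simp: indicator_def)
    qed (rule c)
    also have "\<dots> = 2 * P * M" using that by simp
    finally show ?thesis .
  qed
  show ?thesis
  proof (cases "p = \<infinity>")
    case True
    have "AE y in lebesgue. ennreal (cmod (f' y)) \<le> esssup lebesgue (\<lambda>x. ennreal (cmod (f' x)))"
      by (rule esssup_AE)
    then have "AE y in lborel. ennreal (cmod (f' y)) \<le> ennreal N"
      using norm True by (simp add: Lp_norm_def AE_completion_iff)
    with fG have ae: "AE y in lborel. cmod (G y) \<le> N"
      by eventually_elim (simp add: N)
    show ?thesis
    proof (rule that[of "\<lambda>_. 0"])
      show "AE y in lborel. ennreal (cmod (G y)) \<le> ennreal N * (1 + 0)"
        using ae by eventually_elim (simp add: ennreal_leI)
      fix P :: real assume P: "1 \<le> P"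
      have NP: "2 * P * N \<le> 3 * N * P" using P N by (simp add: mult_right_mono)
      show "(LINT s:{-P..P}|lborel. cmod (G s)) \<le> 3 * N * P powr (1 - (if p = \<infinity> then 0 else 1 / enn2real p))"
        using order_trans[OF bdd[OF ae, of P] NP] P N True by simp
    qed auto
  next
    case False
    define q where "q = enn2real p"
    have q: "1 \<le> q"
      using p False unfolding q_def by (cases p) (auto simp: top_unique)
    define I where "I = (\<integral>\<^sup>+x. ennreal (cmod (f' x) powr q) \<partial>lebesgue)"
    have I: "I = (\<integral>\<^sup>+x. ennreal (cmod (G x) powr q) \<partial>lborel)"
      unfolding I_def nn_integral_completion 
      by (rule nn_integral_cong_AE) (use fG in \<open>eventually_elim, simp\<close>)
    have If: "I \<noteq> \<infinity>" and NI: "ennreal (enn2real I powr (1 / q)) = ennreal N"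
      using norm False unfolding Lp_norm_def Let_def q_def[symmetric] I_def[symmetric]
      by (auto split: if_splits)
    have N_eq: "N = enn2real I powr (1 / q)" using NI N by simp
    have Iq: "I = ennreal (N powr q)"
      using q If unfolding N_eq by (simp add: powr_powr ennreal_enn2real_if)
    show ?thesis
    proof (cases "N = 0")
      case True
      then have "I = 0" using Iq by simp
      then have "AE x in lborel. ennreal (cmod (G x) powr q) = 0"
        unfolding I by (subst (asm) nn_integral_0_iff_AE) auto
      then have ae: "AE x in lborel. cmod (G x) \<le> 0"
        by eventually_elim simp
      show ?thesis
      proof (rule that[of "\<lambda>_. 0"])
        show "AE y in lborel. ennreal (cmod (G y)) \<le> ennreal N * (1 + 0)"
          using ae by eventually_elim simp
        show "(LINT s:{-P..P}|lborel. cmod (G s)) \<le> 3 * N * P powr (1 - (if p = \<infinity> then 0 else 1 / enn2real p))" if "1 \<le> P" for P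
          using bdd[OF ae, of P] that True by simp
      qed auto
    next
      case False
      then have N0: "0 < N" using N by simp
      define u where "u y = (cmod (G y) / N) powr q" for y
      have um [measurable]: "u \<in> borel_measurable borel" unfolding u_def[abs_def] by measurable
      have u0: "0 \<le> u y" for y by (simp add: u_def)
      have uI: "(\<integral>\<^sup>+y. ennreal (u y) \<partial>lborel) = 1"
      proof -
        have "I = (\<integral>\<^sup>+y. ennreal (N powr q) * ennreal (u y) \<partial>lborel)"
          unfolding I using N0 by (intro nn_integral_cong) (simp add: u_def ennreal_mult'[symmetric] powr_divide)
        also have "\<dots> = ennreal (N powr q) * (\<integral>\<^sup>+y. ennreal (u y) \<partial>lborel)"
          by (rule nn_integral_cmult) measurable
        finally have "ennreal (N powr q) * 1 = ennreal (N powr q) * (\<integral>\<^sup>+y. ennreal (u y) \<partial>lborel)"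
          by (simp add: Iq)
        then show ?thesis using N0 by (subst (asm) ennreal_mult_cancel_left) auto
      qed
      have iu: "integrable lborel u"
        by (rule integrableI_nonneg) (use uI u0 in auto)
      have uint: "(LINT y|lborel. u y) = 1"
        using uI u0 by (subst integral_eq_nn_integral) auto
      have young: "cmod (G y) \<le> N * (\<mu> + \<mu> powr (1 - q) * u y)" if \<mu>: "0 < \<mu>" for y \<mu>
      proof -
        define v where "v = cmod (G y) / N"
        have v0: "0 \<le> v" using N0 by (simp add: v_def)
        have "v \<le> \<mu> + \<mu> powr (1 - q) * v powr q"
        proof (cases "v \<le> \<mu>")
          case True
          then show ?thesis by (simp add: add_increasing2)
        next
          case False
          then have vp: "0 < v" using \<mu> by linarith
          have "v = v powr (1 - q) * v powr q" using vp by (simp add: powr_add[symmetric])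
          also have "\<dots> \<le> \<mu> powr (1 - q) * v powr q"
            using False \<mu> q by (intro mult_right_mono powr_mono2') auto
          finally show ?thesis using \<mu> by linarith
        qed
        then have "N * v \<le> N * (\<mu> + \<mu> powr (1 - q) * v powr q)" using N0 by simp
        then show ?thesis using N0 by (simp add: v_def u_def)
      qed
      show ?thesis
      proof (rule that[of "\<lambda>y. ennreal (u y)"])
        show "AE y in lborel. ennreal (cmod (G y)) \<le> ennreal N * (1 + ennreal (u y))"
        proof (rule AE_I2)
          fix y
          have "ennreal (cmod (G y)) \<le> ennreal (N * (1 + u y))"
            using young[of 1 y] by (intro ennreal_leI) simp
          also have "\<dots> = ennreal N * (1 + ennreal (u y))"
            using N0 u0[of y] by (simp add: ennreal_mult)
          finally show "ennreal (cmod (G y)) \<le> ennreal N * (1 + ennreal (u y))" .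
        qed
        show "(\<integral>\<^sup>+y. ennreal (u y) \<partial>lborel) \<le> 1" by (simp add: uI)
        fix P :: real assume P: "1 \<le> P"
        \<comment> \<open>The choice of \<open>\<mu>\<close> that balances the two terms.\<close>
        define \<mu> where "\<mu> = P powr (- (1 / q))"
        have \<mu>: "0 < \<mu>" using P by (simp add: \<mu>_def)
        have "(LINT s:{-P..P}|lborel. cmod (G s)) \<le> (LINT s|lborel. indicator {-P..P} s *\<^sub>R (N * \<mu>) + N * \<mu> powr (1 - q) * u s)"
          unfolding set_lebesgue_integral_def
        proof (rule integral_mono)
          show "integrable lborel (\<lambda>s. indicator {-P..P} s *\<^sub>R cmod (G s))"
            using set_integrable_norm[OF G] by (simp add: set_integrable_def)
          show "integrable lborel (\<lambda>s. indicator {-P..P} s *\<^sub>R (N * \<mu>) + N * \<mu> powr (1 - q) * u s)"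
            using iu by (intro Bochner_Integration.integrable_add c) auto
          show "indicator {-P..P} s *\<^sub>R cmod (G s) \<le> indicator {-P..P} s *\<^sub>R (N * \<mu>) + N * \<mu> powr (1 - q) * u s" for s
            using young[OF \<mu>, of s] N0 u0[of s] by (auto simp: indicator_def algebra_simps)
        qed
        also have "\<dots> = 2 * P * (N * \<mu>) + N * \<mu> powr (1 - q)"
          using iu P by (subst Bochner_Integration.integral_add[OF c]) (auto simp: uint)
        also have "\<mu> powr (1 - q) = P powr (1 - 1 / q)"
        proof -
          have "- (1 / q) * (1 - q) = 1 - 1 / q" using q by (simp add: field_simps)
          then show ?thesis unfolding \<mu>_def powr_powr by (rule arg_cong)
        qed
        also have "2 * P * (N * \<mu>) = 2 * N * P powr (1 - 1 / q)"
          using P by (simp add: \<mu>_def powr_diff powr_minus_divide)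
        finally show "(LINT s:{-P..P}|lborel. cmod (G s)) \<le> 3 * N * P powr (1 - (if p = \<infinity> then 0 else 1 / enn2real p))"
          using \<open>p \<noteq> \<infinity>\<close> by (simp add: q_def)
      qed measurable
    qed
  qed
qed

section \<open>Measurability of the maximal function\<close>

lemma AE_lborel_reflect:
  fixes x :: real
  assumes "AE y in lborel. P y"
  shows "AE t in lborel. P (x - t)"
proof -
  obtain N where N: "N \<in> null_sets lborel" "{y. \<not> P y} \<subseteq> N"
    using assms by (auto simp: eventually_ae_filter)
  then have "N \<in> sets borel" by auto
  then have [measurable]: "Measurable.pred borel (\<lambda>y. y \<notin> N)" by measurable
  have "AE t in lborel. x + - 1 * t \<notin> N"
    by (rule AE_borel_affine) (use AE_not_in[OF N(1)] in auto)
  then show ?thesis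
    by eventually_elim (use N in auto)
qed

lemma borel_measurable_lebesgue_AE_eq:
  fixes f g :: "real \<Rightarrow> 'b::topological_space"
  assumes g: "g \<in> borel_measurable borel" and ae: "AE x in lborel. f x = g x"
  shows "f \<in> borel_measurable lebesgue"
proof (rule measurableI)
  fix A :: "'b set" assume A: "A \<in> sets borel"
  have gA: "g -` A \<inter> space lebesgue \<in> sets lebesgue"
    using borel_measurable_imp_lebesgue[OF g] A by (rule measurable_sets)
  show "f -` A \<inter> space lebesgue \<in> sets lebesgue"
  proof (rule completion.in_sets_AE[OF _ gA])
    show "AE x in lebesgue. x \<in> g -` A \<inter> space lebesgue \<longleftrightarrow> x \<in> f -` A \<inter> space lebesgue"
      using AE_completion[OF ae] by eventually_elim auto
  qed simp
qed simp

lemma right_continuous_SUP_rational: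
  fixes \<phi> :: "real \<Rightarrow> ennreal"
  assumes "\<And>r. 0 < r \<Longrightarrow> (\<phi> \<longlongrightarrow> \<phi> r) (at_right r)"
  shows "(SUP r\<in>{0<..}. \<phi> r) = (SUP r\<in>\<rat> \<inter> {0<..}. \<phi> r)"
proof (rule antisym)
  show "(SUP r\<in>{0<..}. \<phi> r) \<le> (SUP r\<in>\<rat> \<inter> {0<..}. \<phi> r)" (is "_ \<le> ?S")
  proof (rule SUP_least)
    fix r :: real assume "r \<in> {0<..}"
    then have r: "0 < r" by simp
    show "\<phi> r \<le> ?S"
    proof (rule ccontr)
      assume "\<not> \<phi> r \<le> ?S"
      then have "\<forall>\<^sub>F s in at_right r. ?S < \<phi> s"
        using order_tendstoD(1)[OF assms[OF r]] by auto
      then obtain b where b: "r < b" "\<And>s. r < s \<Longrightarrow> s < b \<Longrightarrow> ?S < \<phi> s"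
        by (auto simp: eventually_at_right_field)
      obtain q where q: "q \<in> \<rat>" "r < q" "q < b" using Rats_dense_in_real[OF b(1)] by blast
      then have "\<phi> q \<le> ?S" using r by (intro SUP_upper) auto
      with b(2)[OF q(2,3)] show False by auto
    qed
  qed
qed (rule SUP_subset_mono, auto)

text \<open>The averages are right continuous in the radius by dominated convergence, so rational
  radii suffice.\<close>

lemma osc_maximal_borel_measurable:
  fixes F :: "real \<Rightarrow> complex" and \<theta> :: "real \<times> real \<Rightarrow> real"
  assumes iF: "integrable lborel F" and \<theta> [measurable]: "\<theta> \<in> borel_measurable (borel \<Otimes>\<^sub>M borel)"
  shows "osc_maximal \<theta> F \<in> borel_measurable borel"
proof -
  have [measurable]: "F \<in> borel_measurable borel" using iF by auto
  define k where "k x t = F (x - t) * exp (\<i> * complex_of_real (\<theta> (x, t)))" for x t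
  have [measurable]: "(\<lambda>(x, t). k x t) \<in> borel_measurable (borel \<Otimes>\<^sub>M borel)"
    unfolding k_def by measurable
  have ik: "integrable lborel (k x)" for x
  proof (rule Bochner_Integration.integrable_bound)
    show "integrable lborel (\<lambda>t. F (x - t))"
      using lborel_integrable_real_affine[OF iF, of "-1" x] by simp
    show "AE t in lborel. norm (k x t) \<le> norm (F (x - t))"
      by (simp add: k_def norm_mult)
  qed measurable
  define \<phi> where "\<phi> x r = ennreal (1 / (2 * r) * cmod (LINT t:{-r..r}|lborel. k x t))" for x r
  have osc: "osc_maximal \<theta> F x = (SUP r\<in>{0<..}. \<phi> x r)" for x
  proof -
    have "(LINT t:{-r..r}|lebesgue. k x t) = (LINT t:{-r..r}|lborel. k x t)" for r
      unfolding set_lebesgue_integral_def by (rule integral_completion) measurable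
    then show ?thesis by (simp add: osc_maximal_def \<phi>_def k_def[symmetric])
  qed
  have "(\<phi> x \<longlongrightarrow> \<phi> x r) (at_right r)" if r: "0 < r" for x r
  proof -
    have "((\<lambda>s. LINT t:{-s..s}|lborel. k x t) \<longlongrightarrow> (LINT t:{-r..r}|lborel. k x t)) (at_right r)"
    proof (rule tendsto_at_right_sequentially[of r "r + 1"])
      fix S :: "nat \<Rightarrow> real"
      assume S: "\<And>n. r < S n" "S \<longlonglongrightarrow> r"
      show "(\<lambda>n. LINT t:{-S n..S n}|lborel. k x t) \<longlonglongrightarrow> (LINT t:{-r..r}|lborel. k x t)"
        unfolding set_lebesgue_integral_def
      proof (rule integral_dominated_convergence)
        show "integrable lborel (\<lambda>t. cmod (k x t))" using ik by simp
        show "AE t in lborel. (\<lambda>n. indicator {-S n..S n} t *\<^sub>R k x t) \<longlonglongrightarrow> indicator {-r..r} t *\<^sub>R k x t"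
        proof (rule AE_I2)
          fix t
          show "(\<lambda>n. indicator {-S n..S n} t *\<^sub>R k x t) \<longlonglongrightarrow> indicator {-r..r} t *\<^sub>R k x t"
          proof (cases "\<bar>t\<bar> \<le> r")
            case True
            then have "indicator {-S n..S n} t = (1::real)" for n
              using S(1)[of n] by (auto simp: indicator_def)
            moreover have "indicator {-r..r} t = (1::real)" using True by (auto simp: indicator_def)
            ultimately show ?thesis by simp
          next
            case False
            then have "\<forall>\<^sub>F n in sequentially. S n < \<bar>t\<bar>"
              using order_tendstoD(2)[OF S(2)] by simp
            then have "\<forall>\<^sub>F n in sequentially. indicator {-S n..S n} t *\<^sub>R k x t = indicator {-r..r} t *\<^sub>R k x t"
              by eventually_elim (use False in \<open>auto simp: indicator_def\<close>)
            then show ?thesis by (rule tendsto_eventually)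
          qed
        qed
        show "AE t in lborel. norm (indicator {-S n..S n} t *\<^sub>R k x t) \<le> cmod (k x t)" for n
          by (intro AE_I2) (auto simp: indicator_def)
      qed measurable
    qed simp
    then show ?thesis
      unfolding \<phi>_def using r by (intro tendsto_intros tendsto_ennrealI) auto
  qed
  then have "osc_maximal \<theta> F x = (SUP r\<in>\<rat> \<inter> {0<..}. \<phi> x r)" for x
    unfolding osc by (rule right_continuous_SUP_rational)
  moreover have "(\<lambda>x. SUP r\<in>\<rat> \<inter> {0<..}. \<phi> x r) \<in> borel_measurable borel"
  proof (rule borel_measurable_SUP)
    show "countable (\<rat> \<inter> {0::real<..})" using countable_rat by auto
    show "(\<lambda>x. \<phi> x r) \<in> borel_measurable borel" for r
      unfolding \<phi>_def set_lebesgue_integral_def by measurable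
  qed
  ultimately show ?thesis by (simp add: fun_eq_iff[symmetric] eta_contract_eq cong: measurable_cong)
qed

lemma osc_maximal_cong_AE:
  fixes f F :: "real \<Rightarrow> complex"
  assumes f: "f \<in> borel_measurable lebesgue" and F [measurable]: "F \<in> borel_measurable borel"
    and ae: "AE y in lborel. f y = F y"
    and \<theta> [measurable]: "(\<lambda>t. \<theta> (x, t)) \<in> borel_measurable borel" and eq: "\<And>t. \<gamma> (x, t) = \<theta> (x, t)"
  shows "osc_maximal \<gamma> f x = osc_maximal \<theta> F x"
proof -
  have "(LINT t:{-r..r}|lebesgue. f (x - t) * exp (\<i> * complex_of_real (\<theta> (x, t))))
      = (LINT t:{-r..r}|lebesgue. F (x - t) * exp (\<i> * complex_of_real (\<theta> (x, t))))" for r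
    unfolding set_lebesgue_integral_def
  proof (rule integral_cong_AE)
    define e where "e t = indicator {-r..r} t *\<^sub>R exp (\<i> * complex_of_real (\<theta> (x, t)))" for t
    have "e \<in> borel_measurable borel" unfolding e_def by measurable
    then have em: "e \<in> borel_measurable lebesgue" by (rule borel_measurable_imp_lebesgue)
    have "(\<lambda>t. f (x + (- 1) *\<^sub>R t)) \<in> borel_measurable lebesgue"
      by (rule borel_measurable_affine[OF f]) simp
    then have "(\<lambda>t. f (x - t) * e t) \<in> borel_measurable lebesgue"
      using em by (simp add: borel_measurable_times)
    then show "(\<lambda>t. indicator {-r..r} t *\<^sub>R (f (x - t) * exp (\<i> * complex_of_real (\<theta> (x, t))))) \<in> borel_measurable lebesgue"
      by (simp add: e_def)
    show "(\<lambda>t. indicator {-r..r} t *\<^sub>R (F (x - t) * exp (\<i> * complex_of_real (\<theta> (x, t))))) \<in> borel_measurable lebesgue"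
      by (rule borel_measurable_imp_lebesgue) measurable
    show "AE t in lebesgue. indicator {-r..r} t *\<^sub>R (f (x - t) * exp (\<i> * complex_of_real (\<theta> (x, t)))) =
        indicator {-r..r} t *\<^sub>R (F (x - t) * exp (\<i> * complex_of_real (\<theta> (x, t))))"
      using AE_completion[OF AE_lborel_reflect[OF ae, of x]] by eventually_elim simp
  qed
  then show ?thesis by (simp add: osc_maximal_def eq)
qed

section \<open>Phases with essentially bounded coefficients\<close>

lemma Lp_space_infinity_borel_version:
  fixes c :: "real \<Rightarrow> real"
  assumes "c \<in> Lp_space \<infinity> lebesgue"
  obtains c' C where "c' \<in> borel_measurable borel" "AE x in lborel. c x = c' x" "AE x in lborel. \<bar>c x\<bar> \<le> C"
proof -
  obtain c' where "c' \<in> borel_measurable borel" "AE x in lborel. c x = c' x"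
    using assms completion_ex_borel_measurable_real[of c lborel] by (auto simp: Lp_space_def)
  moreover obtain C where C: "esssup lebesgue (\<lambda>x. ennreal (norm (c x))) = ennreal C" "0 \<le> C"
    using assms by (cases "esssup lebesgue (\<lambda>x. ennreal (norm (c x)))") (auto simp: Lp_space_def Lp_norm_def)
  have "AE x in lebesgue. ennreal (norm (c x)) \<le> ennreal C"
    unfolding C(1)[symmetric] by (rule esssup_AE)
  then have "AE x in lborel. \<bar>c x\<bar> \<le> C"
    unfolding AE_completion_iff by eventually_elim (use C(2) in simp)
  ultimately show ?thesis by (rule that)
qed

text \<open>The phase agrees almost everywhere with a Borel function for which integrals of
  \<open>exp (i \<theta> (x, t))\<close> over intervals at distance \<open>\<rho> \<ge> R\<close> from the origin decay like \<open>\<rho> powr (- \<delta>)\<close>,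
  uniformly in \<open>x\<close>.\<close>

definition osc_phase :: "(real \<times> real \<Rightarrow> real) \<Rightarrow> real \<Rightarrow> bool" where
  "osc_phase \<gamma> \<delta> \<longleftrightarrow> (\<exists>\<theta> R B. \<theta> \<in> borel_measurable (borel \<Otimes>\<^sub>M borel) \<and> (AE x in lborel. \<forall>t. \<gamma> (x, t) = \<theta> (x, t)) \<and>
    1 \<le> R \<and> 0 \<le> B \<and> (AE x in lborel. \<forall>a b \<rho>. R \<le> \<rho> \<longrightarrow> (\<forall>t\<in>{a..b}. \<rho> \<le> \<bar>t\<bar>) \<longrightarrow>
        cmod (LINT t:{a..b}|lborel. exp (\<i> * complex_of_real (\<theta> (x, t)))) \<le> B * \<rho> powr (- \<delta>)))"

text \<open>The coefficients are replaced by Borel representatives. An essential bound for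
  \<open>1 / c m\<close> is a lower bound for the absolute value of \<open>c m\<close>, which is what the derivative test requires.\<close>

lemma power_sum_osc_phase:
  fixes c :: "nat \<Rightarrow> real \<Rightarrow> real" and d :: "nat \<Rightarrow> real"
  assumes m: "1 \<le> m" and c: "\<And>j. j \<in> {1..m} \<Longrightarrow> c j \<in> Lp_space \<infinity> lebesgue"
    and nz: "AE x in lebesgue. c m x \<noteq> 0" and inv: "(\<lambda>x. 1 / c m x) \<in> Lp_space \<infinity> lebesgue"
    and d: "2 \<le> d 1" "strict_mono_on {1..m} d"
    and \<gamma>: "\<And>x t. \<gamma> (x, t) = (\<Sum>j=1..m. c j x * \<bar>t\<bar> powr d j)"
  shows "osc_phase \<gamma> (d m - 1)"
proof -
  have "\<exists>c'. \<forall>j\<in>{1..m}. \<exists>C. c' j \<in> borel_measurable borel \<and> (AE x in lborel. c j x = c' j x) \<and> (AE x in lborel. \<bar>c j x\<bar> \<le> C)"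
  proof (intro bchoice ballI)
    fix j assume "j \<in> {1..m}"
    show "\<exists>c' C. c' \<in> borel_measurable borel \<and> (AE x in lborel. c j x = c' x) \<and> (AE x in lborel. \<bar>c j x\<bar> \<le> C)"
      using Lp_space_infinity_borel_version[OF c[OF \<open>j \<in> {1..m}\<close>]] by blast
  qed
  then obtain c' where "\<forall>j\<in>{1..m}. \<exists>C. c' j \<in> borel_measurable borel \<and> (AE x in lborel. c j x = c' j x) \<and> (AE x in lborel. \<bar>c j x\<bar> \<le> C)"
    by blast
  from bchoice[OF this] obtain C where c': "\<And>j. j \<in> {1..m} \<Longrightarrow> c' j \<in> borel_measurable borel"
      "\<And>j. j \<in> {1..m} \<Longrightarrow> AE x in lborel. c j x = c' j x" "\<And>j. j \<in> {1..m} \<Longrightarrow> AE x in lborel. \<bar>c j x\<bar> \<le> C j"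
    by blast
  obtain D where D: "AE x in lborel. \<bar>1 / c m x\<bar> \<le> D"
    using Lp_space_infinity_borel_version[OF inv] by blast
  define C0 where "C0 = (\<Sum>j=1..m. \<bar>C j\<bar>)"
  \<comment> \<open>The added \<open>1\<close> keeps \<open>\<kappa>\<close> positive and well defined for every essential bound \<open>D\<close>.\<close>
  define \<kappa> where "\<kappa> = 1 / (\<bar>D\<bar> + 1)"
  have C0: "0 \<le> C0" by (simp add: C0_def sum_nonneg)
  have \<kappa>: "0 < \<kappa>" by (simp add: \<kappa>_def)
  have Cj: "C j \<le> C0" if "j \<in> {1..m}" for j
    unfolding C0_def using member_le_sum[of j "{1..m}" "\<lambda>j. \<bar>C j\<bar>"] that by force
  define \<theta> where "\<theta> = (\<lambda>(x, t). \<Sum>j=1..m. c' j x * \<bar>t\<bar> powr d j :: real)"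
  have \<theta>m: "\<theta> \<in> borel_measurable (borel \<Otimes>\<^sub>M borel)"
    unfolding \<theta>_def split_beta
  proof (rule borel_measurable_sum)
    fix j assume "j \<in> {1..m}"
    note [measurable] = c'(1)[OF this]
    show "(\<lambda>p. c' j (fst p) * \<bar>snd p\<bar> powr d j) \<in> borel_measurable (borel \<Otimes>\<^sub>M borel)" by measurable
  qed
  obtain R B where RB: "1 \<le> R" "0 \<le> B" and osc: "\<And>c a b \<rho>. (\<forall>j\<in>{1..m}. \<bar>c j\<bar> \<le> C0) \<Longrightarrow> \<kappa> \<le> \<bar>c m\<bar> \<Longrightarrow> R \<le> \<rho> \<Longrightarrow> (\<forall>t\<in>{a..b}. \<rho> \<le> \<bar>t\<bar>) \<Longrightarrow>
     cmod (LINT t:{a..b}|lborel. exp (\<i> * complex_of_real (\<Sum>j=1..m. c j * \<bar>t\<bar> powr d j))) \<le> B * \<rho> powr (- (d m - 1))"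
    using power_sum_phase_oscillation[OF m d(2,1) C0 \<kappa>] by blast
  have eq: "AE x in lborel. \<forall>j\<in>{1..m}. c j x = c' j x"
    by (rule AE_finite_allI) (auto intro: c'(2))
  have le: "AE x in lborel. \<forall>j\<in>{1..m}. \<bar>c j x\<bar> \<le> C j"
    by (rule AE_finite_allI) (auto intro: c'(3))
  have nz': "AE x in lborel. c m x \<noteq> 0" using nz by (simp add: AE_completion_iff)
  show ?thesis
    unfolding osc_phase_def
  proof (intro exI conjI)
    show "\<theta> \<in> borel_measurable (borel \<Otimes>\<^sub>M borel)" "1 \<le> R" "0 \<le> B" by fact+
    show "AE x in lborel. \<forall>t. \<gamma> (x, t) = \<theta> (x, t)"
      using eq by eventually_elim (simp add: \<gamma> \<theta>_def)
    show "AE x in lborel. \<forall>a b \<rho>. R \<le> \<rho> \<longrightarrow> (\<forall>t\<in>{a..b}. \<rho> \<le> \<bar>t\<bar>) \<longrightarrow>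
        cmod (LINT t:{a..b}|lborel. exp (\<i> * complex_of_real (\<theta> (x, t)))) \<le> B * \<rho> powr (- (d m - 1))"
      using eq le D nz'
    proof eventually_elim
      case (elim x)
      have mm: "m \<in> {1..m}" using m by simp
      have 1: "\<forall>j\<in>{1..m}. \<bar>c' j x\<bar> \<le> C0"
        using elim(1,2) Cj by (metis order_trans)
      have "1 / \<bar>c m x\<bar> \<le> \<bar>D\<bar> + 1" using elim(3) by simp
      then have "\<kappa> \<le> \<bar>c m x\<bar>"
        using elim(4) by (simp add: \<kappa>_def field_simps)
      then have 2: "\<kappa> \<le> \<bar>c' m x\<bar>" using elim(1) mm by simp
      show ?case
        using osc[of "\<lambda>j. c' j x", OF 1 2] by (simp add: \<theta>_def)
    qed
  qed
qed

text \<open>The exponent \<open>1 - 1 / p\<close> is the growth rate of the variation of an element of the space. The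
  far part of the maximal function is integrable when the decay \<open>\<delta>\<close> of the phase beats it.
  Positivity of \<open>K\<close> settles the weak derivatives of infinite norm.\<close>

lemma osc_maximal_bounded_on_C_space:
  assumes l: "1 < l" "l < 2" and p: "1 \<le> p"
    and phase: "osc_phase \<gamma> \<delta>" and \<delta>: "1 - (if p = \<infinity> then 0 else 1 / enn2real p) < \<delta>"
  shows "\<exists>K::real. \<forall>f\<in>C_space p l.
    osc_maximal \<gamma> f \<in> borel_measurable lebesgue \<and>
    (\<forall>f'. has_weak_derivative f f' \<longrightarrow>
      (\<integral>\<^sup>+ x. osc_maximal \<gamma> f x \<partial>lebesgue) \<le>
        ennreal K * (Lp_norm 1 lebesgue (\<lambda>x. (1 + \<bar>x\<bar> powr l) *\<^sub>R f x) + Lp_norm p lebesgue f'))"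
proof -
  obtain \<theta> R B where \<theta> [measurable]: "\<theta> \<in> borel_measurable (borel \<Otimes>\<^sub>M borel)"
    and eq: "AE x in lborel. \<forall>t. \<gamma> (x, t) = \<theta> (x, t)" and R: "1 \<le> R" and B: "0 \<le> B"
    and osc: "AE x in lborel. \<forall>a b \<rho>. R \<le> \<rho> \<longrightarrow> (\<forall>t\<in>{a..b}. \<rho> \<le> \<bar>t\<bar>) \<longrightarrow>
        cmod (LINT t:{a..b}|lborel. exp (\<i> * complex_of_real (\<theta> (x, t)))) \<le> B * \<rho> powr (- \<delta>)"
    using phase by (auto simp: osc_phase_def)
  have \<theta>x: "(\<lambda>t. \<theta> (x, t)) \<in> borel_measurable borel" for x by measurable
  \<comment> \<open>With \<open>1 / \<infinity>\<close> read as \<open>0\<close>.\<close>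
  define \<sigma> where "\<sigma> = 1 - (if p = \<infinity> then 0 else 1 / enn2real p)"
  have \<sigma>0: "0 \<le> \<sigma>"
  proof (cases "p = \<infinity>")
    case False
    then have "1 \<le> enn2real p" using p by (cases p) (auto simp: top_unique)
    with False show ?thesis by (simp add: \<sigma>_def)
  qed (simp add: \<sigma>_def)
  have \<sigma>: "0 \<le> \<sigma>" "\<sigma> < \<delta>" using \<sigma>0 \<delta> by (auto simp: \<sigma>_def)
  define K where "K = 23 + 4 * R + 4 / (l - 1) + 12 * B / (\<delta> - \<sigma>)"
  have K: "0 < K" unfolding K_def using R l B \<sigma> by (intro add_pos_nonneg) auto
  show ?thesis
  proof (intro exI[of _ K] ballI)
    fix f assume "f \<in> C_space p l"
    then obtain g where wf: "(\<lambda>x. (1 + \<bar>x\<bar> powr l) *\<^sub>R f x) \<in> Lp_space 1 lebesgue" and g: "has_weak_derivative f g"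
      by (auto simp: C_space_def)
    have fm: "f \<in> borel_measurable lebesgue"
      using g by (auto simp: has_weak_derivative_def intro: locally_integrable_measurable)
    have W: "Lp_norm 1 lebesgue (\<lambda>x. (1 + \<bar>x\<bar> powr l) *\<^sub>R f x) = (\<integral>\<^sup>+x. ennreal (weight l x * cmod (f x)) \<partial>lborel)"
      by (simp add: Lp_norm_def Let_def nn_integral_completion ennreal_enn2real_if weight_def)
    have Wfin: "(\<integral>\<^sup>+x. ennreal (weight l x * cmod (f x)) \<partial>lborel) < \<infinity>"
      using wf by (simp add: Lp_space_def W)
    obtain f0 where f0 [measurable]: "f0 \<in> borel_measurable borel" and ff0: "AE x in lborel. f x = f0 x"
      using ex_borel_version_complex[OF fm] by blast
    have "integrable lborel f0"
    proof (rule integrableI_bounded)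
      have "(\<integral>\<^sup>+x. ennreal (cmod (f0 x)) \<partial>lborel) \<le> (\<integral>\<^sup>+x. ennreal (weight l x * cmod (f x)) \<partial>lborel)"
      proof (rule nn_integral_mono_AE)
        show "AE x in lborel. ennreal (cmod (f0 x)) \<le> ennreal (weight l x * cmod (f x))"
          using ff0
        proof eventually_elim
          case (elim x)
          show ?case using mult_right_mono[OF weight_ge_1[of l x] norm_ge_zero[of "f x"]] elim by (simp add: ennreal_leI)
        qed
      qed
      then show "(\<integral>\<^sup>+x. ennreal (norm (f0 x)) \<partial>lborel) < \<infinity>" using Wfin by (rule le_less_trans)
    qed measurable
    then have "osc_maximal \<theta> f0 \<in> borel_measurable borel"
      by (rule osc_maximal_borel_measurable[OF _ \<theta>])
    moreover have "AE x in lborel. osc_maximal \<gamma> f x = osc_maximal \<theta> f0 x"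
      using eq by eventually_elim (intro osc_maximal_cong_AE fm f0 ff0 \<theta>x, auto)
    ultimately have meas: "osc_maximal \<gamma> f \<in> borel_measurable lebesgue"
      by (rule borel_measurable_lebesgue_AE_eq)
    have bound: "(\<integral>\<^sup>+ x. osc_maximal \<gamma> f x \<partial>lebesgue) \<le>
        ennreal K * (Lp_norm 1 lebesgue (\<lambda>x. (1 + \<bar>x\<bar> powr l) *\<^sub>R f x) + Lp_norm p lebesgue f')"
      if f': "has_weak_derivative f f'" for f'
    proof (cases "Lp_norm p lebesgue f' = \<infinity>")
      case True
      then show ?thesis using K by (simp add: ennreal_mult_top)
    next
      case False
      then obtain N where N: "Lp_norm p lebesgue f' = ennreal N" "0 \<le> N"
        by (cases "Lp_norm p lebesgue f'") auto
      obtain F G where FG: "G \<in> borel_measurable borel" "\<And>a b. set_integrable lborel {a..b} G"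
          "AE x in lborel. f x = F x" "AE x in lborel. f' x = G x"
          "\<And>x y. x \<le> y \<Longrightarrow> F y - F x = (LINT s:{x..y}|lborel. G s)"
        by (rule weak_derivative_imp_indefinite_integral[OF f']) (rule that)
      have Fm: "F \<in> borel_measurable borel"
        using continuous_indefinite_integral[OF FG(2,5)] by (rule borel_measurable_continuous_onI)
      obtain h where h: "h \<in> borel_measurable borel" "AE y in lborel. ennreal (cmod (G y)) \<le> ennreal N * (1 + h y)"
          "(\<integral>\<^sup>+y. h y \<partial>lborel) \<le> 1"
          "\<And>P. 1 \<le> P \<Longrightarrow> (LINT s:{-P..P}|lborel. cmod (G s)) \<le> 3 * N * P powr \<sigma>"
        by (rule Lp_norm_growth[OF p FG(1,2,4) N, folded \<sigma>_def]) (rule that)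
      have WF: "(\<integral>\<^sup>+x. ennreal (weight l x * cmod (f x)) \<partial>lborel) = (\<integral>\<^sup>+x. ennreal (weight l x * cmod (F x)) \<partial>lborel)"
        by (rule nn_integral_cong_AE) (use FG(3) in \<open>eventually_elim, simp\<close>)
      have "(\<integral>\<^sup>+ x. osc_maximal \<gamma> f x \<partial>lebesgue) = (\<integral>\<^sup>+ x. osc_maximal \<theta> F x \<partial>lborel)"
        unfolding nn_integral_completion
        by (rule nn_integral_cong_AE) (use eq in \<open>eventually_elim, intro osc_maximal_cong_AE fm Fm FG(3) \<theta>x, auto\<close>)
      also have "\<dots> \<le> ennreal K * ((\<integral>\<^sup>+x. ennreal (weight l x * cmod (F x)) \<partial>lborel) + ennreal N)"
        unfolding K_def
        by (rule osc_maximal_integral_bound[OF l FG(1) h(1) FG(2,5) Fm _ N(2) B R \<sigma> h(2,3,4) \<theta>x osc])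
          (use Wfin WF in auto)
      finally show ?thesis by (simp add: W WF N(1))
    qed
    show "osc_maximal \<gamma> f \<in> borel_measurable lebesgue \<and>
      (\<forall>f'. has_weak_derivative f f' \<longrightarrow>
      (\<integral>\<^sup>+ x. osc_maximal \<gamma> f x \<partial>lebesgue) \<le>
        ennreal K * (Lp_norm 1 lebesgue (\<lambda>x. (1 + \<bar>x\<bar> powr l) *\<^sub>R f x) + Lp_norm p lebesgue f'))"
      using meas bound by blast
  qed
qed

lemma power_phase_imp_osc_phase:
  assumes "power_phase \<gamma>"
  shows "\<exists>\<delta>>1. osc_phase \<gamma> \<delta>"
  using assms unfolding power_phase_def
proof (elim exE conjE)
  fix m :: nat and c :: "nat \<Rightarrow> real \<Rightarrow> real" and d :: "nat \<Rightarrow> real"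
  assume m: "1 \<le> m" and c: "\<forall>j\<in>{1..m}. c j \<in> Lp_space \<infinity> lebesgue"
    and inv: "AE x in lebesgue. c m x \<noteq> 0" "(\<lambda>x. 1 / c m x) \<in> Lp_space \<infinity> lebesgue"
    and d: "2 \<le> d 1" "strict_mono_on {1..m} d" "2 < d m"
    and \<gamma>: "\<forall>x t. \<gamma> (x, t) = (\<Sum>j=1..m. c j x * \<bar>t\<bar> powr d j)"
  have "osc_phase \<gamma> (d m - 1)"
    by (rule power_sum_osc_phase[where m = m and c = c and d = d]) (use m c inv d \<gamma> in blast)+
  then show ?thesis using d(3) by (intro exI[of _ "d m - 1"]) auto
qed

lemma quadratic_phase_imp_osc_phase:
  assumes "quadratic_phase \<gamma>"
  shows "osc_phase \<gamma> 1"
  using assms unfolding quadratic_phase_def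
proof (elim exE conjE)
  fix a
  assume a: "a \<in> Lp_space \<infinity> lebesgue" "AE x in lebesgue. a x \<noteq> 0" "(\<lambda>x. 1 / a x) \<in> Lp_space \<infinity> lebesgue"
    and \<gamma>: "\<forall>x t. \<gamma> (x, t) = a x * t\<^sup>2"
  have "osc_phase \<gamma> ((\<lambda>_::nat. 2) 1 - 1)"
  proof (rule power_sum_osc_phase[where c = "\<lambda>_. a"])
    show "\<gamma> (x, t) = (\<Sum>j=1..1::nat. a x * \<bar>t\<bar> powr 2)" for x t
      using \<gamma> by (cases "t = 0") auto
  qed (use a in \<open>auto simp: strict_mono_on_def\<close>)
  then show ?thesis by simp
qed

theorem theorem1p2:
  fixes \<gamma> :: "real \<times> real \<Rightarrow> real" and p :: ennreal and l :: real
  assumes "\<gamma> \<in> borel_measurable lebesgue"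
    and "(power_phase \<gamma> \<and> 1 < l \<and> l < 2 \<and> 1 \<le> p \<and> p \<le> \<infinity>) \<or>
         (quadratic_phase \<gamma> \<and> 1 < l \<and> l < 2 \<and> 1 \<le> p \<and> p < \<infinity>)"
  shows "\<exists>K::real. \<forall>f\<in>C_space p l.
    osc_maximal \<gamma> f \<in> borel_measurable lebesgue \<and>
    (\<forall>f'. has_weak_derivative f f' \<longrightarrow>
      (\<integral>\<^sup>+ x. osc_maximal \<gamma> f x \<partial>lebesgue) \<le>
        ennreal K * (Lp_norm 1 lebesgue (\<lambda>x. (1 + \<bar>x\<bar> powr l) *\<^sub>R f x) + Lp_norm p lebesgue f'))"
  using assms(2)
proof
  assume A: "power_phase \<gamma> \<and> 1 < l \<and> l < 2 \<and> 1 \<le> p \<and> p \<le> \<infinity>"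
  then obtain \<delta> where \<delta>: "1 < \<delta>" "osc_phase \<gamma> \<delta>"
    using power_phase_imp_osc_phase by blast
  moreover have "1 - (if p = \<infinity> then 0 else 1 / enn2real p) \<le> 1"
    by simp
  ultimately show ?thesis
    using A by (intro osc_maximal_bounded_on_C_space[OF _ _ _ \<delta>(2)]) linarith+
next
  assume A: "quadratic_phase \<gamma> \<and> 1 < l \<and> l < 2 \<and> 1 \<le> p \<and> p < \<infinity>"
  then have "0 < p" by (metis less_le_trans zero_less_one)
  with A have "0 < enn2real p"
    by (simp add: enn2real_positive_iff)
  then have "1 - (if p = \<infinity> then 0 else 1 / enn2real p) < 1"
    using A by auto
  then show ?thesis
    using A by (intro osc_maximal_bounded_on_C_space[OF _ _ _ quadratic_phase_imp_osc_phase]) auto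
qed

end
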